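(* Let $w\ge 4$ and let $C=(C_1,C_2)$ be an equitable $2$-partition of the Johnson graph $J(2w,w)$ whose quotient matrix has $\lambda_2(2w,w)=(w-2)^2-2$ as an eigenvalue. If $w\ge 7$, then $C$ is equivalent to one of the partitions $P_1,P_2,P_3,P_4$ defined below. If $w\in\{4,5,6\}$, then, with the cells ordered so that the quotient matrix $\begin{pmatrix} a& b\\ c& d\end{pmatrix}$ satisfies $b\ge c$, the quotient matrix of $C$ is one of $$\begin{pmatrix} w^2-3w+2 & 3w-2\\ w & w^2-w\end{pmatrix},\quad \begin{pmatrix} w^2-2w & 2w\\ 2w-2 & w^2-2w+2\end{pmatrix},\quad \begin{pmatrix} w^2-3w & 3w\\ w-2 & w^2-w+2\end{pmatrix}.$$
   Context: The Johnson graph $J(n,w)$ has as vertices the binary vectors $x=(x_1,\dots,x_n)$ of length $n$ with exactly $w$ ones; two vertices are adjacent iff they have exactly $w-1$ common ones. Its eigenvalues are $\lambda_i(n,w)=(w-i)(n-w-i)-i$, $i=0,\dots,w$. A $2$-partition $(C_1,C_2)$ of the vertex set into two nonempty cells is equitable with quotient matrix $S=(s_{ij})$ if every vertex of $C_i$ has exactly $s_{ij}$ neighbours in $C_j$. Two functions $f_1,f_2$ on the vertices of $J(n,w)$ are equivalent if there is a permutation $\pi\in S_n$ of coordinates with $f_1(x)=f_2(\pi x)$ for all $x$. Two equitable $2$-partitions $(C_1,C_2)$ and $(C_1',C_2')$ are equivalent if the characteristic function $\chi_{C_1}$ is equivalent to $\chi_{C_1'}$ or to $\chi_{C_2'}$.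 The partitions $P_k=(C_1,C_2)$ of $J(2w,w)$, with $C_2$ the complement of $C_1$, are: $P_1$: $C_1=\{x: (x_1,\dots,x_5)\in B_1\}$ with $B_1=\{10000,11000,10100,00011,01111,00111,01011,11100\}$ (vectors written as strings); $P_2$: $C_1=\{x: x_1+x_2\in\{0,2\}\}$; $P_3$: $C_1=\{x:(x_1,\dots,x_5)\in B_3\}$ with $B_3=\{00000,00100,00010,00001,10100,01010,00101,00011,11111,11011,11101,11110,01011,10101,11010,11100\}$; $P_4$: $C_1=\{x:(x_1,x_2,x_3)\in\{000,111\}\}$. *)

theory Defs
  imports Complex_Main "HOL-Combinatorics.Permutations"
begin

text \<open>Binary vectors of length n with w ones are encoded as subsets of {0..<n};
  coordinate x_i of the paper (i = 1..n) is the membership of i-1.\<close>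

definition johnson_vertices :: "nat \<Rightarrow> nat \<Rightarrow> nat set set" where
  "johnson_vertices n w = {x. x \<subseteq> {0..<n} \<and> card x = w}"

definition johnson_adj :: "nat \<Rightarrow> nat \<Rightarrow> nat set \<Rightarrow> nat set \<Rightarrow> bool" where
  "johnson_adj n w x y \<longleftrightarrow> x \<in> johnson_vertices n w \<and> y \<in> johnson_vertices n w
      \<and> card (x \<inter> y) = w - 1"

definition equitable_2partition ::
  "nat \<Rightarrow> nat \<Rightarrow> nat set set \<Rightarrow> nat set set \<Rightarrow> nat \<Rightarrow> nat \<Rightarrow> nat \<Rightarrow> nat \<Rightarrow> bool" where
  "equitable_2partition n w C1 C2 a b c d \<longleftrightarrow>
     C1 \<noteq> {} \<and> C2 \<noteq> {} \<and> C1 \<inter> C2 = {} \<and> C1 \<union> C2 = johnson_vertices n w \<and>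
     (\<forall>x\<in>C1. card {y\<in>C1. johnson_adj n w x y} = a \<and> card {y\<in>C2. johnson_adj n w x y} = b) \<and>
     (\<forall>x\<in>C2. card {y\<in>C1. johnson_adj n w x y} = c \<and> card {y\<in>C2. johnson_adj n w x y} = d)"

definition is_eigenvalue_2x2 :: "real \<Rightarrow> real \<Rightarrow> real \<Rightarrow> real \<Rightarrow> real \<Rightarrow> bool" where
  "is_eigenvalue_2x2 a b c d l \<longleftrightarrow>
     (\<exists>v1 v2. (v1, v2) \<noteq> (0, 0) \<and> a * v1 + b * v2 = l * v1 \<and> c * v1 + d * v2 = l * v2)"

definition johnson_eigenvalue :: "nat \<Rightarrow> nat \<Rightarrow> nat \<Rightarrow> real" where
  "johnson_eigenvalue n w i = (real w - real i) * (real n - real w - real i) - real i"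

definition equivalent_funs :: "nat \<Rightarrow> nat \<Rightarrow> (nat set \<Rightarrow> 'b) \<Rightarrow> (nat set \<Rightarrow> 'b) \<Rightarrow> bool" where
  "equivalent_funs n w f1 f2 \<longleftrightarrow>
     (\<exists>\<pi>. \<pi> permutes {0..<n} \<and> (\<forall>x\<in>johnson_vertices n w. f1 x = f2 (\<pi> ` x)))"

definition equivalent_partitions ::
  "nat \<Rightarrow> nat \<Rightarrow> nat set set \<times> nat set set \<Rightarrow> nat set set \<times> nat set set \<Rightarrow> bool" where
  "equivalent_partitions n w P Q \<longleftrightarrow>
     equivalent_funs n w (\<lambda>x. x \<in> fst P) (\<lambda>x. x \<in> fst Q) \<or>
     equivalent_funs n w (\<lambda>x. x \<in> fst P) (\<lambda>x. x \<in> snd Q)"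

definition bits :: "nat \<Rightarrow> nat set \<Rightarrow> nat list" where
  "bits k x = map (\<lambda>i. if i \<in> x then 1 else 0) [0..<k]"

definition B1 :: "nat list set" where
  "B1 = {[1,0,0,0,0],[1,1,0,0,0],[1,0,1,0,0],[0,0,0,1,1],
         [0,1,1,1,1],[0,0,1,1,1],[0,1,0,1,1],[1,1,1,0,0]}"

definition B3 :: "nat list set" where
  "B3 = {[0,0,0,0,0],[0,0,1,0,0],[0,0,0,1,0],[0,0,0,0,1],
         [1,0,1,0,0],[0,1,0,1,0],[0,0,1,0,1],[0,0,0,1,1],
         [1,1,1,1,1],[1,1,0,1,1],[1,1,1,0,1],[1,1,1,1,0],
         [0,1,0,1,1],[1,0,1,0,1],[1,1,0,1,0],[1,1,1,0,0]}"

definition P_cell1 :: "nat \<Rightarrow> nat \<Rightarrow> nat set set" where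
  "P_cell1 k w = {x\<in>johnson_vertices (2*w) w.
      (if k = 1 then bits 5 x \<in> B1
       else if k = 2 then sum_list (bits 2 x) \<in> {0, 2}
       else if k = 3 then bits 5 x \<in> B3
       else bits 3 x \<in> {[0,0,0],[1,1,1]})}"

definition P_part :: "nat \<Rightarrow> nat \<Rightarrow> nat set set \<times> nat set set" where
  "P_part k w = (P_cell1 k w, johnson_vertices (2*w) w - P_cell1 k w)"

end

theory Submission
  imports Defs
begin

text \<open>Let \<open>f\<close> be the characteristic function of \<open>C\<^sub>1\<close> and \<open>D\<^sub>i\<^sub>j f (y) = f (y \<union> {i}) - f (y \<union> {j})\<close>, a function
  on \<open>J(n - 2, w - 1)\<close>. The operator \<open>D\<^sub>i\<^sub>j\<close> raises an eigenvalue by 1, so a third difference of \<open>f\<close> is an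
  eigenfunction whose eigenvalue exceeds the degree of the graph and therefore vanishes. Hence every
  \<open>D\<^sub>i\<^sub>j f\<close> is linear; it is also odd under complementation. As it takes values in \<open>{-1, 0, 1}\<close>, it is
  \<open>(\<plusminus>s\<^sub>a \<plusminus> s\<^sub>b) / 2\<close> for two (possibly equal) coordinates, where \<open>s\<^sub>c = 1\<close> or \<open>-1\<close> according to membership
  of \<open>c\<close>.

  Call \<open>i\<close>, \<open>j\<close> twins if \<open>D\<^sub>i\<^sub>j f = 0\<close>. Comparing \<open>D\<^sub>i\<^sub>j f\<close> and \<open>D\<^sub>k\<^sub>l f\<close> for disjoint pairs shows that for
  \<open>w \<ge> 5\<close> all but at most five coordinates are pairwise twins. So \<open>f\<close> is a Boolean function of at most
  five variables, and the shape of its derivatives forces it to be a comparison of two variables (\<open>P\<^sub>2\<close>)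
  or a multiplexer between two such comparisons (\<open>P\<^sub>1\<close>, \<open>P\<^sub>3\<close>, \<open>P\<^sub>4\<close>).\<close>

subsection \<open>Slices and twins\<close>

text \<open>The ground set is arbitrary because every difference operator deletes two coordinates
  from it.\<close>

definition slice :: "'a set \<Rightarrow> nat \<Rightarrow> 'a set set" where
  "slice V m = {x. x \<subseteq> V \<and> card x = m}"

text \<open>The adjacency operator of the Johnson graph: each pair \<open>(i, j)\<close> gives one
  neighbour of \<open>x\<close>.\<close>

definition nbsum :: "'a set \<Rightarrow> ('a set \<Rightarrow> int) \<Rightarrow> 'a set \<Rightarrow> int" where
  "nbsum V f x = (\<Sum>i\<in>x. \<Sum>j\<in>V - x. f (insert j (x - {i})))"

text \<open>The number \<open>m\<close> is the size of the common part, so the condition concerns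
  \<open>f\<close> on \<open>slice V (Suc m)\<close>.\<close>

definition twin :: "'a set \<Rightarrow> nat \<Rightarrow> ('a set \<Rightarrow> int) \<Rightarrow> 'a \<Rightarrow> 'a \<Rightarrow> bool" where
  "twin V m f i j \<longleftrightarrow> (\<forall>y\<in>slice (V - {i, j}) m. f (insert i y) = f (insert j y))"

text \<open>Signs instead of 0 and 1 make linear forms odd under complementation.\<close>

definition sg :: "'a \<Rightarrow> 'a set \<Rightarrow> int" where
  "sg c x = (if c \<in> x then 1 else - 1)"

definition lin :: "'a set \<Rightarrow> ('a \<Rightarrow> int) \<Rightarrow> 'a set \<Rightarrow> int" where
  "lin U h x = (\<Sum>c\<in>U. h c * sg c x)"

lemma finite_slice [simp]: "finite V \<Longrightarrow> finite (slice V m)"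
  unfolding slice_def by simp

lemma slice_finite_mem: "finite V \<Longrightarrow> x \<in> slice V m \<Longrightarrow> finite x"
  unfolding slice_def using finite_subset by auto

lemma insert_in_slice:
  "finite V \<Longrightarrow> y \<in> slice (V - A) m \<Longrightarrow> i \<in> V \<Longrightarrow> i \<in> A \<Longrightarrow> insert i y \<in> slice V (Suc m)"
  by (subgoal_tac "i \<notin> y \<and> finite y") (auto simp: slice_def intro: finite_subset)

lemma slice_nonempty:
  assumes "finite V" "m \<le> card V" shows "\<exists>x. x \<in> slice V m"
  using obtain_subset_with_card_n[OF assms(2)] unfolding slice_def by auto

text \<open>Exchanging an element of \<open>x - x'\<close> for one of \<open>x' - x\<close> stays
  inside \<open>T\<close>, preserves \<open>f\<close>, and shrinks \<open>x - x'\<close>.\<close>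

lemma slice_const_mod_twins:
  assumes fin: "finite V" and TV: "T \<subseteq> V"
    and tw: "\<And>i j. i \<in> T \<Longrightarrow> j \<in> T \<Longrightarrow> i \<noteq> j \<Longrightarrow> twin V m f i j"
  shows "x \<in> slice V (Suc m) \<Longrightarrow> x' \<in> slice V (Suc m) \<Longrightarrow> x - T = x' - T \<Longrightarrow> f x = f x'"
proof (induction "card (x - x')" arbitrary: x)
  case 0
  have "finite x" "finite x'" using 0 fin slice_finite_mem by blast+
  then have "x \<subseteq> x'" using 0 by auto
  then have "x = x'" using 0 \<open>finite x'\<close> card_subset_eq[of x' x] unfolding slice_def by simp
  then show ?case by simp
next
  case (Suc k)
  have fx: "finite x" "finite x'" using Suc fin slice_finite_mem by blast+
  have cx: "card x = Suc m" "card x' = Suc m" "x \<subseteq> V" "x' \<subseteq> V" using Suc unfolding slice_def by auto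
  have "x - x' \<noteq> {}" using Suc by force
  then obtain i where i: "i \<in> x" "i \<notin> x'" by auto
  have "\<not> x' \<subseteq> x" using cx fx i card_subset_eq by metis
  then obtain j where j: "j \<in> x'" "j \<notin> x" by auto
  have ijT: "i \<in> T" "j \<in> T" "i \<noteq> j" using i j Suc.prems by auto
  let ?y = "x - {i}"
  have y: "?y \<in> slice (V - {i, j}) m" using cx i j fx unfolding slice_def by auto
  have "f (insert i ?y) = f (insert j ?y)" using tw[OF ijT] y unfolding twin_def by blast
  moreover have "insert i ?y = x" using i by auto
  moreover have "f (insert j ?y) = f x'"
  proof (rule Suc.hyps(1))
    have "insert j ?y - x' = (x - x') - {i}" using i j by auto
    then show "k = card (insert j ?y - x')" using Suc.hyps(2) i fx by simp
    show "insert j ?y \<in> slice V (Suc m)" using insert_in_slice[OF fin y, of j] ijT TV by auto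
    show "insert j ?y - T = x' - T" using Suc.prems ijT by auto
  qed (use Suc in auto)
  ultimately show ?case by simp
qed

lemma slice_const:
  assumes "finite V" "\<And>i j. i \<in> V \<Longrightarrow> j \<in> V \<Longrightarrow> i \<noteq> j \<Longrightarrow> twin V m f i j"
    "x \<in> slice V (Suc m)" "x' \<in> slice V (Suc m)"
  shows "f x = f x'"
  using slice_const_mod_twins[OF assms(1) subset_refl assms(2-4)] assms(3,4)
  unfolding slice_def by blast

lemma twin_sym: "twin V m f i j \<Longrightarrow> twin V m f j i"
  unfolding twin_def by (metis insert_commute)

lemma twin_trans:
  assumes fin: "finite V" and ne: "i \<noteq> k" "j \<noteq> i" "j \<noteq> k" and j: "j \<in> V" "i \<in> V" "k \<in> V"
    and ij: "twin V m f i j" and jk: "twin V m f j k"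
  shows "twin V m f i k"
  unfolding twin_def
proof
  fix y assume y: "y \<in> slice (V - {i, k}) m"
  have fy: "finite y" using y fin slice_finite_mem by blast
  show "f (insert i y) = f (insert k y)"
  proof (cases "j \<in> y")
    case False
    have "y \<in> slice (V - {i, j}) m" "y \<in> slice (V - {j, k}) m" using y False unfolding slice_def by auto
    then show ?thesis using ij jk unfolding twin_def by metis
  \<comment> \<open>With \<open>j\<close> in \<open>y\<close> the exchange goes in two moves: first
    \<open>j\<close> to \<open>k\<close>, then \<open>i\<close> to \<open>j\<close>.\<close>
  next
    case True
    define z where "z = y - {j}"
    have yz: "y = insert j z" "j \<notin> z" using True z_def by auto
    have "insert i z \<in> slice (V - {j, k}) m" "insert k z \<in> slice (V - {i, j}) m"
      using y yz fy ne j unfolding slice_def by (auto simp: card_insert_if)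
    then have "f (insert j (insert i z)) = f (insert k (insert i z))"
      "f (insert i (insert k z)) = f (insert j (insert k z))"
      using ij jk unfolding twin_def by auto
    then show ?thesis using yz by (simp add: insert_commute)
  qed
qed

subsection \<open>Eigenfunctions and differences\<close>

text \<open>Neighbours containing neither or both of \<open>i\<close>, \<open>j\<close> are common
  to \<open>insert i y\<close> and \<open>insert j y\<close> and cancel. The exchange of
  \<open>i\<close> with \<open>j\<close> contributes minus the difference itself, which is the shift
  of the eigenvalue by 1.\<close>

lemma nbsum_diff:
  assumes fin: "finite V" and ij: "i \<in> V" "j \<in> V" "i \<noteq> j" and y: "y \<subseteq> V - {i, j}"
  shows "nbsum (V - {i, j}) (\<lambda>z. f (insert i z) - f (insert j z)) y
       = nbsum V f (insert i y) - nbsum V f (insert j y) + (f (insert i y) - f (insert j y))"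
proof -
  define W where "W = V - {i, j} - y"
  have fy: "finite y" "finite W" using fin y finite_subset W_def by auto
  have nin: "i \<notin> y" "j \<notin> y" "i \<notin> W" "j \<notin> W" using y W_def by auto
  \<comment> \<open>The summands: \<open>i\<close> leaves for an element of \<open>W\<close>;
    \<open>i\<close> leaves for \<open>j\<close>; an element of \<open>y\<close> leaves for one of
    \<open>W\<close>; an element of \<open>y\<close> leaves for \<open>j\<close>. The local
    \<open>i\<close>, \<open>j\<close> are generic, so both orders are covered.\<close>
  have *: "nbsum V f (insert i y) = (\<Sum>q\<in>W. f (insert q y)) + f (insert j y)
      + (\<Sum>p\<in>y. \<Sum>q\<in>W. f (insert i (insert q (y - {p})))) + (\<Sum>p\<in>y. f (insert i (insert j (y - {p}))))"
    if ij: "i \<in> V" "j \<in> V" "i \<noteq> j" and nin: "i \<notin> y" "j \<notin> y" "i \<notin> W" "j \<notin> W" and W: "W = V - {i, j} - y" for i j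
  proof -
    have e: "V - insert i y = insert j W" using W ij nin by auto
    have e2: "insert i y - {i} = y" using nin by auto
    have e3: "insert q (insert i y - {p}) = insert i (insert q (y - {p}))" if "p \<in> y" for p q
      using that nin by auto
    show ?thesis unfolding nbsum_def e
      using fy nin by (simp add: e2 e3 sum.distrib insert_commute algebra_simps)
  qed
  have W': "W = V - {j, i} - y" using W_def by auto
  note a = *[OF ij nin W_def] and b = *[OF ij(2,1) ij(3)[symmetric] nin(2,1,4,3) W']
  have c: "nbsum (V - {i, j}) (\<lambda>z. f (insert i z) - f (insert j z)) y =
    (\<Sum>p\<in>y. \<Sum>q\<in>W. f (insert i (insert q (y - {p})))) - (\<Sum>p\<in>y. \<Sum>q\<in>W. f (insert j (insert q (y - {p}))))"
    unfolding nbsum_def W_def[symmetric] by (simp add: sum_subtractf)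
  have d: "(\<Sum>p\<in>y. f (insert i (insert j (y - {p})))) = (\<Sum>p\<in>y. f (insert j (insert i (y - {p}))))"
    by (simp add: insert_commute)
  show ?thesis unfolding a b c d by simp
qed

text \<open>The constant \<open>\<kappa>\<close> admits a characteristic function without
  subtracting its mean; one difference removes it.\<close>

definition eigenfun :: "'a set \<Rightarrow> nat \<Rightarrow> int \<Rightarrow> int \<Rightarrow> ('a set \<Rightarrow> int) \<Rightarrow> bool" where
  "eigenfun V m \<mu> \<kappa> f \<longleftrightarrow> (\<forall>x\<in>slice V m. nbsum V f x = \<mu> * f x + \<kappa>)"

lemma eigenfun_diff:
  assumes "finite V" "i \<in> V" "j \<in> V" "i \<noteq> j" "eigenfun V (Suc m) \<mu> \<kappa> f"
  shows "eigenfun (V - {i, j}) m (\<mu> + 1) 0 (\<lambda>z. f (insert i z) - f (insert j z))"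
  unfolding eigenfun_def
proof
  fix y assume y: "y \<in> slice (V - {i, j}) m"
  then have "insert i y \<in> slice V (Suc m)" "insert j y \<in> slice V (Suc m)" "y \<subseteq> V - {i, j}"
    using insert_in_slice[OF assms(1) y] assms(2,3) unfolding slice_def by auto
  then show "nbsum (V - {i, j}) (\<lambda>z. f (insert i z) - f (insert j z)) y
     = (\<mu> + 1) * (f (insert i y) - f (insert j y)) + 0"
    using nbsum_diff[OF assms(1-4), of y f] assms(5) unfolding eigenfun_def
    by (auto simp: algebra_simps)
qed

text \<open>Maximum principle: at a maximum of the absolute value of \<open>f\<close> the neighbour
  sum is at most the degree \<open>m * (card V - m)\<close> times that maximum.\<close>

lemma eigenfun_above_degree:
  assumes fin: "finite V" and e: "eigenfun V m \<mu> 0 f" and mu: "int m * (int (card V) - int m) < \<mu>"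
    and x: "x \<in> slice V m"
  shows "f x = 0"
proof -
  define M where "M = Max ((\<lambda>x. \<bar>f x\<bar>) ` slice V m)"
  have fi: "finite ((\<lambda>x. \<bar>f x\<bar>) ` slice V m)" using fin by simp
  have "M \<in> (\<lambda>x. \<bar>f x\<bar>) ` slice V m" unfolding M_def using fi x by (intro Max_in) auto
  then obtain z where z: "z \<in> slice V m" "\<bar>f z\<bar> = M" by auto
  have le: "\<bar>f u\<bar> \<le> M" if "u \<in> slice V m" for u unfolding M_def using fi that by (intro Max_ge) auto
  have fz: "finite z" "z \<subseteq> V" "card z = m" using z fin slice_finite_mem unfolding slice_def by auto
  have "\<bar>nbsum V f z\<bar> \<le> (\<Sum>i\<in>z. \<bar>\<Sum>j\<in>V - z. f (insert j (z - {i}))\<bar>)"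
    unfolding nbsum_def by (rule sum_abs)
  also have "\<dots> \<le> (\<Sum>i\<in>z. \<Sum>j\<in>V - z. \<bar>f (insert j (z - {i}))\<bar>)"
    by (intro sum_mono sum_abs)
  also have "\<dots> \<le> (\<Sum>i\<in>z. \<Sum>j\<in>V - z. M)"
  proof (intro sum_mono le)
    fix i j assume "i \<in> z" "j \<in> V - z"
    then show "insert j (z - {i}) \<in> slice V m"
      using fz unfolding slice_def
      by (auto simp: card_insert_if) (metis Suc_pred card_gt_0_iff empty_iff)
  qed
  also have "\<dots> = int m * (int (card V) - int m) * M"
    using fz fin card_mono[of V z] by (simp add: card_Diff_subset of_nat_diff)
  finally have "\<bar>\<mu> * f z\<bar> \<le> int m * (int (card V) - int m) * M"
    using e z unfolding eigenfun_def by simp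
  then have "\<bar>\<mu>\<bar> * M \<le> int m * (int (card V) - int m) * M"
    using z by (simp add: abs_mult)
  then have "M \<le> 0" using mu mult_le_cancel_right[of "\<bar>\<mu>\<bar>" M "int m * (int (card V) - int m)"] by auto
  then show ?thesis using le[OF x] by auto
qed

section \<open>Linear forms in signs and functions with constant differences on a middle
  slice\<close>

lemma lin_swap:
  assumes "finite U" "k \<in> U" "l \<in> U" "k \<noteq> l" "y \<subseteq> U - {k, l}"
  shows "lin U h (insert k y) - lin U h (insert l y) = 2 * (h k - h l)"
proof -
  have *: "lin U h x = lin (U - {k, l}) h x + (h k * sg k x + h l * sg l x)" for x
    unfolding lin_def using sum.subset_diff[of "{k, l}" U "\<lambda>c. h c * sg c x"] assms by simp
  have "lin (U - {k, l}) h (insert k y) = lin (U - {k, l}) h (insert l y)"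
    unfolding lin_def sg_def by (intro sum.cong) auto
  then show ?thesis unfolding * using assms by (auto simp: sg_def)
qed

lemma lin_compl: "x \<subseteq> U \<Longrightarrow> lin U h (U - x) = - lin U h x"
  unfolding lin_def sum_negf[symmetric] by (intro sum.cong) (auto simp: sg_def)

text \<open>Complementation swaps the removed and the added element, so it is a graph
  isomorphism.\<close>

lemma nbsum_compl:
  assumes "x \<subseteq> U"
  shows "nbsum U (\<lambda>z. g (U - z)) x = nbsum U g (U - x)"
proof -
  have "nbsum U g (U - x) = (\<Sum>j\<in>U - x. \<Sum>i\<in>x. g (insert i (U - x - {j})))"
    unfolding nbsum_def using assms by (simp add: double_diff)
  also have "\<dots> = (\<Sum>i\<in>x. \<Sum>j\<in>U - x. g (insert i (U - x - {j})))" by (rule sum.swap)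
  also have "\<dots> = nbsum U (\<lambda>z. g (U - z)) x"
    unfolding nbsum_def
  proof (intro sum.cong refl)
    fix i j assume "i \<in> x" "j \<in> U - x"
    then have "insert i (U - x - {j}) = U - insert j (x - {i})" using assms by auto
    then show "g (insert i (U - x - {j})) = g (U - insert j (x - {i}))" by simp
  qed
  finally show ?thesis by simp
qed

lemma slice_compl:
  "finite U \<Longrightarrow> card U = 2 * m \<Longrightarrow> x \<in> slice U m \<Longrightarrow> U - x \<in> slice U m"
  unfolding slice_def by (auto simp: card_Diff_subset finite_subset)

text \<open>Complementing reverses the roles of \<open>k\<close> and \<open>l\<close>, so a constant
  difference cancels in the even part \<open>s\<close>. Hence \<open>s\<close> is constant, and a
  nonzero constant would have the degree as its eigenvalue.\<close>

lemma odd_of_const_diff: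
  assumes fin: "finite U" and cU: "card U = 2 * Suc m"
    and c: "\<And>k l. k \<in> U \<Longrightarrow> l \<in> U \<Longrightarrow> k \<noteq> l \<Longrightarrow>
       \<exists>c. \<forall>y\<in>slice (U - {k, l}) m. g (insert k y) - g (insert l y) = c"
    and e: "eigenfun U (Suc m) \<mu> 0 g" and mu: "\<mu> \<noteq> int (Suc m) * int (Suc m)"
    and x: "x \<in> slice U (Suc m)"
  shows "g (U - x) = - g x"
proof -
  define s where "s z = g z + g (U - z)" for z
  have "twin U m s k l" if kl: "k \<in> U" "l \<in> U" "k \<noteq> l" for k l
    unfolding twin_def
  proof
    fix y assume y: "y \<in> slice (U - {k, l}) m"
    have c2: "card (U - {k, l}) = 2 * m" using kl cU fin by simp
    let ?y' = "U - {k, l} - y"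
    have y': "?y' \<in> slice (U - {k, l}) m" using slice_compl[OF _ c2 y] fin by simp
    have "U - insert k y = insert l ?y'" "U - insert l y = insert k ?y'"
      using kl y unfolding slice_def by auto
    moreover obtain d where "\<And>z. z \<in> slice (U - {k, l}) m \<Longrightarrow> g (insert k z) - g (insert l z) = d"
      using c[OF kl] by blast
    note this[OF y] this[OF y']
    ultimately show "s (insert k y) = s (insert l y)" unfolding s_def by simp
  qed
  then have const: "s z = s x" if "z \<in> slice U (Suc m)" for z
    using slice_const[OF fin _ that x] by blast
  have xc: "U - x \<in> slice U (Suc m)" using slice_compl[OF fin cU x] .
  have xs: "x \<subseteq> U" "card x = Suc m" "finite x" using x fin slice_finite_mem unfolding slice_def by auto
  have "nbsum U s x = nbsum U g x + nbsum U (\<lambda>z. g (U - z)) x"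
    unfolding nbsum_def s_def by (simp add: sum.distrib)
  also have "\<dots> = \<mu> * s x" using e x xc unfolding eigenfun_def nbsum_compl[OF xs(1)] s_def
    by (simp add: algebra_simps)
  finally have 1: "nbsum U s x = \<mu> * s x" .
  have "nbsum U s x = (\<Sum>i\<in>x. \<Sum>j\<in>U - x. s x)"
    unfolding nbsum_def
  proof (intro sum.cong refl const)
    fix i j assume ij: "i \<in> x" "j \<in> U - x"
    then have "x - {i} \<in> slice (U - {i, j}) m" using xs unfolding slice_def by auto
    then show "insert j (x - {i}) \<in> slice U (Suc m)" using insert_in_slice[OF fin] ij by blast
  qed
  also have "\<dots> = int (Suc m) * int (Suc m) * s x"
    using xs cU fin by (simp add: card_Diff_subset)
  finally have "(\<mu> - int (Suc m) * int (Suc m)) * s x = 0" using 1 by (simp add: algebra_simps)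
  then have "s x = 0" using mu by auto
  then show ?thesis unfolding s_def by simp
qed

text \<open>The coefficients are the constant differences against a base point \<open>p\<close>.
  Then \<open>2 * g\<close> minus the form has no differences left, so it is constant; being odd, it
  is 0. The factor 2 arises because a sign changes by 2.\<close>

lemma linear_of_const_diff:
  assumes fin: "finite U" and cU: "card U = 2 * Suc m" and m: "m \<ge> 1"
    and c: "\<And>k l. k \<in> U \<Longrightarrow> l \<in> U \<Longrightarrow> k \<noteq> l \<Longrightarrow>
       \<exists>c. \<forall>y\<in>slice (U - {k, l}) m. g (insert k y) - g (insert l y) = c"
    and od: "\<And>x. x \<in> slice U (Suc m) \<Longrightarrow> g (U - x) = - g x"
  shows "\<exists>h. \<forall>x\<in>slice U (Suc m). 2 * g x = lin U h x"
proof -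
  have "U \<noteq> {}" using cU by auto
  then obtain p where p: "p \<in> U" by auto
  have "\<forall>k\<in>U - {p}. \<exists>c. \<forall>y\<in>slice (U - {k, p}) m. g (insert k y) - g (insert p y) = c"
    using c p by auto
  then obtain h0 where h0: "\<And>k y. k \<in> U - {p} \<Longrightarrow> y \<in> slice (U - {k, p}) m \<Longrightarrow>
      g (insert k y) - g (insert p y) = h0 k"
    using bchoice[of "U - {p}" "\<lambda>k c. \<forall>y\<in>slice (U - {k, p}) m. g (insert k y) - g (insert p y) = c"] by auto
  define h where "h = h0(p := 0)"
  have hd: "g (insert k y) - g (insert l y) = h k - h l"
    if kl: "k \<in> U" "l \<in> U" "k \<noteq> l" and y: "y \<in> slice (U - {k, l}) m" for k l y
  proof -
    consider "k = p" | "l = p" | "k \<noteq> p" "l \<noteq> p" by auto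
    then show ?thesis
    proof cases
      case 1
      then show ?thesis using h0[of l y] kl y unfolding h_def by (simp add: insert_commute)
    next
      case 2
      then show ?thesis using h0[of k y] kl y unfolding h_def by simp
    next
      case 3
      \<comment> \<open>The constant difference of \<open>k\<close> and \<open>l\<close> may be
        evaluated at any point. A point avoiding \<open>p\<close> as well, available for
        \<open>m \<ge> 1\<close>, lets it telescope through \<open>p\<close>.\<close>
      have "card (U - {k, l, p}) = 2 * Suc m - 3" using kl p 3 cU fin by (simp add: card_Diff_subset)
      then obtain z where z: "z \<in> slice (U - {k, l, p}) m"
        using slice_nonempty[of "U - {k, l, p}" m] fin m by fastforce
      then have zz: "z \<in> slice (U - {k, l}) m" "z \<in> slice (U - {k, p}) m" "z \<in> slice (U - {l, p}) m"
        unfolding slice_def by auto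
      have "g (insert k z) - g (insert l z) = h k - h l"
        using h0[of k z] h0[of l z] zz kl 3 unfolding h_def by simp
      moreover have "g (insert k y) - g (insert l y) = g (insert k z) - g (insert l z)"
        using c[OF kl] y zz by fastforce
      ultimately show ?thesis by simp
    qed
  qed
  define r where "r x = 2 * g x - lin U h x" for x
  have tw: "twin U m r k l" if "k \<in> U" "l \<in> U" "k \<noteq> l" for k l
    unfolding twin_def
  proof
    fix y assume y: "y \<in> slice (U - {k, l}) m"
    have "y \<subseteq> U - {k, l}" using y unfolding slice_def by auto
    then show "r (insert k y) = r (insert l y)"
      using hd[OF that y] lin_swap[OF fin that, of y h] unfolding r_def by (simp add: algebra_simps)
  qed
  have "2 * g x = lin U h x" if x: "x \<in> slice U (Suc m)" for x
  proof -
    have "r (U - x) = r x" using slice_const[OF fin tw slice_compl[OF fin cU x] x] by blast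
    moreover have "x \<subseteq> U" using x unfolding slice_def by auto
    ultimately show ?thesis unfolding r_def using od[OF x] lin_compl[of x U h] by simp
  qed
  then show ?thesis by blast
qed

text \<open>Take a slice element \<open>x\<close> maximising \<open>g\<close> and let \<open>t\<close> be the least value of \<open>h\<close> on \<open>x\<close>. Then
  \<open>h - t\<close> is nonnegative on \<open>x\<close> and nonpositive off \<open>x\<close>, so its \<open>l\<^sub>1\<close> norm is \<open>2 * g x\<close>.\<close>
lemma small_linear_form:
  assumes fin: "finite U" and cU: "card U = 2 * Suc m"
    and h: "\<And>x. x \<in> slice U (Suc m) \<Longrightarrow> 2 * g x = lin U h x"
    and g: "\<And>x. x \<in> slice U (Suc m) \<Longrightarrow> g x \<in> {- 1, 0, 1}"
  shows "\<exists>h. (\<Sum>c\<in>U. \<bar>h c\<bar>) \<in> {0, 2} \<and> (\<forall>x\<in>slice U (Suc m). 2 * g x = lin U h x)"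
proof -
  define M where "M = Max (g ` slice U (Suc m))"
  have fi: "finite (g ` slice U (Suc m))" using fin by simp
  have "slice U (Suc m) \<noteq> {}" using slice_nonempty[OF fin, of "Suc m"] cU by auto
  then have "M \<in> g ` slice U (Suc m)" unfolding M_def using fi by (intro Max_in) auto
  then obtain x where x: "x \<in> slice U (Suc m)" "g x = M" by auto
  have le: "g u \<le> g x" if "u \<in> slice U (Suc m)" for u
    unfolding x(2) M_def using fi that by (intro Max_ge) auto
  have xs: "x \<subseteq> U" "card x = Suc m" "finite x" using x fin slice_finite_mem unfolding slice_def by auto
  \<comment> \<open>Exchanging \<open>k\<close> for \<open>l\<close> cannot raise \<open>g\<close>
    above its maximum.\<close>
  have dom: "h l \<le> h k" if kl: "k \<in> x" "l \<in> U - x" for k l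
  proof -
    have k: "k \<in> U" "l \<in> U" "k \<noteq> l" using kl xs by auto
    have y: "x - {k} \<in> slice (U - {k, l}) m" using kl xs unfolding slice_def by auto
    then have il: "insert l (x - {k}) \<in> slice U (Suc m)" using insert_in_slice[OF fin y, of l] k by auto
    have ik: "insert k (x - {k}) = x" using kl by auto
    have "lin U h x - lin U h (insert l (x - {k})) = 2 * (h k - h l)"
      using lin_swap[OF fin k, of "x - {k}" h] y unfolding ik slice_def by auto
    then have "h k - h l = g x - g (insert l (x - {k}))" using h[OF il] h[OF x(1)] by simp
    then show ?thesis using le[OF il] by simp
  qed
  define t where "t = Min (h ` x)"
  have "t \<in> h ` x" unfolding t_def using xs by (intro Min_in) auto
  then obtain k0 where k0: "k0 \<in> x" "h k0 = t" by auto
  have t1: "t \<le> h k" if "k \<in> x" for k unfolding t_def using that xs by (intro Min_le) auto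
  have t2: "h k \<le> t" if "k \<in> U - x" for k using dom[OF k0(1) that] k0 by simp
  define h' where "h' c = h c - t" for c
  \<comment> \<open>On the middle slice the signs sum to 0, so shifting \<open>h\<close> by a
    constant leaves the form unchanged.\<close>
  have one: "lin U (\<lambda>_. t) z = 0" if z: "z \<in> slice U (Suc m)" for z
  proof -
    have zs: "z \<subseteq> U" "card z = Suc m" "finite z" using z fin slice_finite_mem unfolding slice_def by auto
    have "lin U (\<lambda>_. t) z = (\<Sum>c\<in>z. t * sg c z) + (\<Sum>c\<in>U - z. t * sg c z)"
      unfolding lin_def using sum.subset_diff[OF zs(1) fin] by (simp add: add.commute)
    also have "\<dots> = 0" using zs cU fin by (simp add: sg_def card_Diff_subset)
    finally show ?thesis .
  qed
  have form: "2 * g z = lin U h' z" if z: "z \<in> slice U (Suc m)" for z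
  proof -
    have "lin U h' z = lin U h z - lin U (\<lambda>_. t) z"
      unfolding lin_def h'_def sum_subtractf[symmetric] by (intro sum.cong) (auto simp: algebra_simps)
    then show ?thesis using h[OF z] one[OF z] by simp
  qed
  have "(\<Sum>c\<in>U. \<bar>h' c\<bar>) = lin U h' x"
    unfolding lin_def
  proof (intro sum.cong refl)
    fix c assume "c \<in> U"
    then show "\<bar>h' c\<bar> = h' c * sg c x" using t1[of c] t2[of c] unfolding h'_def sg_def by auto
  qed
  then have "(\<Sum>c\<in>U. \<bar>h' c\<bar>) = 2 * g x" using form[OF x(1)] by simp
  moreover have "(\<Sum>c\<in>U. \<bar>h' c\<bar>) \<ge> 0" by (intro sum_nonneg) auto
  ultimately have "(\<Sum>c\<in>U. \<bar>h' c\<bar>) \<in> {0, 2}" using g[OF x(1)] by auto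
  then show ?thesis using form by blast
qed

section \<open>Differences of the eigenfunction: linearity and parity\<close>

lemma second_diff_const:
  assumes fin: "finite V" and cV: "card V = 2 * (k + 3)"
    and e: "eigenfun V (k + 3) ((int k + 1)\<^sup>2 - 2) \<kappa> f"
    and ij: "i \<in> V" "j \<in> V" "i \<noteq> j" and pq: "p \<in> V - {i, j}" "q \<in> V - {i, j}" "p \<noteq> q"
  shows "\<exists>c. \<forall>y\<in>slice (V - {i, j} - {p, q}) (Suc k).
     (f (insert i (insert p y)) - f (insert j (insert p y))) -
     (f (insert i (insert q y)) - f (insert j (insert q y))) = c"
proof -
  have k3: "k + 3 = Suc (Suc (Suc k))" by simp
  let ?g = "\<lambda>z. f (insert i z) - f (insert j z)"
  let ?W = "V - {i, j} - {p, q}"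
  let ?g2 = "\<lambda>z. ?g (insert p z) - ?g (insert q z)"
  have e1: "eigenfun (V - {i, j}) (Suc (Suc k)) ((int k + 1)\<^sup>2 - 2 + 1) 0 ?g"
    using eigenfun_diff[OF fin ij, of "Suc (Suc k)", OF e[unfolded k3]] .
  have e2: "eigenfun ?W (Suc k) ((int k + 1)\<^sup>2 - 2 + 1 + 1) 0 ?g2"
    using eigenfun_diff[OF _ pq e1] fin by simp
  have cW: "card ?W = 2 * k + 2"
    using ij pq cV fin by (simp add: card_Diff_subset)
  have "twin ?W k ?g2 r s" if rs: "r \<in> ?W" "s \<in> ?W" "r \<noteq> s" for r s
  proof -
    have e3: "eigenfun (?W - {r, s}) k ((int k + 1)\<^sup>2 - 2 + 1 + 1 + 1) 0 (\<lambda>z. ?g2 (insert r z) - ?g2 (insert s z))"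
      using eigenfun_diff[OF _ rs e2] fin by simp
    \<comment> \<open>After three differences \<open>w = k + 3\<close> has dropped to
      \<open>k\<close> on \<open>2 * k\<close> coordinates: the degree is \<open>k * k\<close>,
      while the eigenvalue has risen to \<open>(k + 1)\<^sup>2 + 1\<close>.\<close>
    have "card (?W - {r, s}) = 2 * k" using cW rs fin by (simp add: card_Diff_subset)
    then have "int k * (int (card (?W - {r, s})) - int k) < (int k + 1)\<^sup>2 - 2 + 1 + 1 + 1"
      by (simp add: power2_eq_square algebra_simps)
    then show ?thesis
      unfolding twin_def using eigenfun_above_degree[OF _ e3] fin by auto
  qed
  then have "?g2 y = ?g2 y'" if "y \<in> slice ?W (Suc k)" "y' \<in> slice ?W (Suc k)" for y y'
    using slice_const[of ?W k ?g2 y y'] fin that by simp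
  then show ?thesis by metis
qed

text \<open>The difference has eigenvalue \<open>(k + 1)\<^sup>2 - 1\<close>, which is not the
  degree \<open>(k + 2)\<^sup>2\<close>, so it has no constant part.\<close>

lemma diff_odd:
  assumes fin: "finite V" and cV: "card V = 2 * (k + 3)"
    and e: "eigenfun V (k + 3) ((int k + 1)\<^sup>2 - 2) \<kappa> f"
    and ij: "i \<in> V" "j \<in> V" "i \<noteq> j" and x: "x \<in> slice (V - {i, j}) (k + 2)"
  shows "f (insert i (V - {i, j} - x)) - f (insert j (V - {i, j} - x))
       = - (f (insert i x) - f (insert j x))"
proof -
  have k3: "k + 3 = Suc (Suc (Suc k))" by simp
  show ?thesis
  proof (rule odd_of_const_diff[where m = "Suc k" and \<mu> = "(int k + 1)\<^sup>2 - 2 + 1"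
        and g = "\<lambda>z. f (insert i z) - f (insert j z)"])
    show "card (V - {i, j}) = 2 * Suc (Suc k)" using cV ij fin by simp
    show "eigenfun (V - {i, j}) (Suc (Suc k)) ((int k + 1)\<^sup>2 - 2 + 1) 0 (\<lambda>z. f (insert i z) - f (insert j z))"
      using eigenfun_diff[OF fin ij, of "Suc (Suc k)", OF e[unfolded k3]] .
    show "(int k + 1)\<^sup>2 - 2 + 1 \<noteq> int (Suc (Suc k)) * int (Suc (Suc k))"
      by (simp add: power2_eq_square algebra_simps)
    show "x \<in> slice (V - {i, j}) (Suc (Suc k))" using x by simp
  qed (use fin second_diff_const[OF fin cV e ij] in auto)
qed

lemma diff_linear_form:
  assumes fin: "finite V" and cV: "card V = 2 * (k + 3)"
    and e: "eigenfun V (k + 3) ((int k + 1)\<^sup>2 - 2) \<kappa> f"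
    and f01: "\<And>x. f x \<in> {0, 1}"
    and ij: "i \<in> V" "j \<in> V" "i \<noteq> j"
  shows "\<exists>h. (\<Sum>c\<in>V - {i, j}. \<bar>h c\<bar>) \<in> {0, 2} \<and>
     (\<forall>x\<in>slice (V - {i, j}) (k + 2). 2 * (f (insert i x) - f (insert j x)) = lin (V - {i, j}) h x)"
proof -
  let ?g = "\<lambda>z. f (insert i z) - f (insert j z)"
  have cU: "card (V - {i, j}) = 2 * Suc (Suc k)" using cV ij fin by simp
  have "\<exists>h. \<forall>x\<in>slice (V - {i, j}) (Suc (Suc k)). 2 * ?g x = lin (V - {i, j}) h x"
    using second_diff_const[OF fin cV e ij] diff_odd[OF fin cV e ij]
    by (intro linear_of_const_diff) (use fin cU in auto)
  then obtain h where "\<And>x. x \<in> slice (V - {i, j}) (Suc (Suc k)) \<Longrightarrow> 2 * ?g x = lin (V - {i, j}) h x"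
    by blast
  moreover have "?g x \<in> {- 1, 0, 1}" for x using f01[of "insert i x"] f01[of "insert j x"] by auto
  ultimately show ?thesis
    using small_linear_form[of "V - {i, j}" "Suc k" ?g h] fin cU by simp
qed

text \<open>Since all differences of \<open>f\<close> are odd, \<open>s\<close> has none and is
  constant; complementing also negates it, so it vanishes.\<close>

lemma even_of_eigenfun:
  assumes fin: "finite V" and cV: "card V = 2 * (k + 3)"
    and e: "eigenfun V (k + 3) ((int k + 1)\<^sup>2 - 2) \<kappa> f"
    and x: "x \<in> slice V (k + 3)"
  shows "f (V - x) = f x"
proof -
  define s where "s z = f z - f (V - z)" for z
  have "twin V (k + 2) s i j" if ij: "i \<in> V" "j \<in> V" "i \<noteq> j" for i j
    unfolding twin_def
  proof
    fix y assume y: "y \<in> slice (V - {i, j}) (k + 2)"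
    then have "V - insert i y = insert j (V - {i, j} - y)" "V - insert j y = insert i (V - {i, j} - y)"
      using ij unfolding slice_def by auto
    then show "s (insert i y) = s (insert j y)" unfolding s_def using diff_odd[OF fin cV e ij y] by simp
  qed
  then have "s (V - x) = s x"
    using slice_const[OF fin, of "k + 2" s "V - x" x] slice_compl[OF fin cV x] x by (simp add: numeral_3_eq_3)
  moreover have "V - (V - x) = x" using x unfolding slice_def by auto
  ultimately show ?thesis unfolding s_def by simp
qed

subsection \<open>A large set of twins\<close>

lemma sum_pair:
  fixes F :: "'a \<Rightarrow> int"
  assumes "finite U" "a \<in> U" "b \<in> U" "a \<noteq> b" "\<And>c. c \<in> U - {a, b} \<Longrightarrow> F c = 0"
  shows "sum F U = F a + F b"
  using sum.mono_neutral_right[of U "{a, b}" F] assms by auto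

lemma abs_sum_two_cases:
  fixes h :: "'a \<Rightarrow> int"
  assumes "finite U" "(\<Sum>c\<in>U. \<bar>h c\<bar>) = 2"
  obtains a where "a \<in> U" "\<bar>h a\<bar> = 2" "\<And>c. c \<in> U - {a} \<Longrightarrow> h c = 0"
  | a b where "a \<in> U" "b \<in> U" "a \<noteq> b" "\<bar>h a\<bar> = 1" "\<bar>h b\<bar> = 1" "\<And>c. c \<in> U - {a, b} \<Longrightarrow> h c = 0"
proof -
  have "\<exists>a\<in>U. h a \<noteq> 0" using assms by (metis abs_zero sum.neutral zero_neq_numeral)
  then obtain a where a: "a \<in> U" "h a \<noteq> 0" by auto
  have s1: "(\<Sum>c\<in>U - {a}. \<bar>h c\<bar>) = 2 - \<bar>h a\<bar>"
    using sum.remove[of U a "\<lambda>c. \<bar>h c\<bar>"] assms a by simp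
  have nn: "(\<Sum>c\<in>W. \<bar>h c\<bar>) \<ge> 0" for W by (intro sum_nonneg) auto
  show thesis
  proof (cases "\<bar>h a\<bar> = 2")
    case True
    then have "(\<Sum>c\<in>U - {a}. \<bar>h c\<bar>) = 0" using s1 by simp
    then have "h c = 0" if "c \<in> U - {a}" for c
      using sum_nonneg_eq_0_iff[of "U - {a}" "\<lambda>c. \<bar>h c\<bar>"] assms that by auto
    then show thesis using that(1) a True by blast
  next
    case False
    then have ha: "\<bar>h a\<bar> = 1" using a s1 nn[of "U - {a}"] by linarith
    then have s1': "(\<Sum>c\<in>U - {a}. \<bar>h c\<bar>) = 1" using s1 by simp
    then have "\<exists>b\<in>U - {a}. h b \<noteq> 0" by (metis (no_types, lifting) abs_zero sum.neutral zero_neq_one)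
    then obtain b where b: "b \<in> U - {a}" "h b \<noteq> 0" by auto
    have s2: "(\<Sum>c\<in>U - {a} - {b}. \<bar>h c\<bar>) = 1 - \<bar>h b\<bar>"
      using sum.remove[of "U - {a}" b "\<lambda>c. \<bar>h c\<bar>"] assms b s1' by simp
    have hb: "\<bar>h b\<bar> = 1" using b s2 nn[of "U - {a} - {b}"] by linarith
    then have "(\<Sum>c\<in>U - {a} - {b}. \<bar>h c\<bar>) = 0" using s2 by simp
    then have "h c = 0" if "c \<in> U - {a, b}" for c
      using sum_nonneg_eq_0_iff[of "U - {a} - {b}" "\<lambda>c. \<bar>h c\<bar>"] assms that by auto
    then show thesis using that(2) a b ha hb by blast
  qed
qed

text \<open>\<open>H i j\<close> is the coefficient vector of twice the difference in
  \<open>i\<close>, \<open>j\<close>. It is extended by zero so that vectors of different pairs can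
  be compared and multiplied over the same set \<open>V\<close>.\<close>

locale slice_boolean =
  fixes V :: "'a set" and w :: nat and f :: "'a set \<Rightarrow> int" and H :: "'a \<Rightarrow> 'a \<Rightarrow> 'a \<Rightarrow> int"
  assumes fin: "finite V" and cV: "card V = 2 * w" and w5: "w \<ge> 5"
    and f01: "f x \<in> {0, 1}"
    and H_out: "c \<notin> V - {i, j} \<Longrightarrow> H i j c = 0"
    and H_norm: "i \<in> V \<Longrightarrow> j \<in> V \<Longrightarrow> i \<noteq> j \<Longrightarrow> (\<Sum>c\<in>V. \<bar>H i j c\<bar>) \<in> {0, 2}"
    and H_lin: "i \<in> V \<Longrightarrow> j \<in> V \<Longrightarrow> i \<noteq> j \<Longrightarrow> x \<in> slice (V - {i, j}) (w - 1) \<Longrightarrow>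
       2 * (f (insert i x) - f (insert j x)) = lin (V - {i, j}) (H i j) x"
begin

abbreviation tw :: "'a \<Rightarrow> 'a \<Rightarrow> bool" where "tw i j \<equiv> twin V (w - 1) f i j"

lemma twin_if_zero:
  assumes "i \<in> V" "j \<in> V" "i \<noteq> j" "\<And>c. c \<in> V \<Longrightarrow> H i j c = 0"
  shows "tw i j"
  unfolding twin_def
proof
  fix y assume "y \<in> slice (V - {i, j}) (w - 1)"
  then have "2 * (f (insert i y) - f (insert j y)) = 0"
    using H_lin[OF assms(1-3)] assms(4) unfolding lin_def by simp
  then show "f (insert i y) = f (insert j y)" by simp
qed

lemma norm_two_if_not_twin:
  assumes "i \<in> V" "j \<in> V" "i \<noteq> j" "\<not> tw i j"
  shows "(\<Sum>c\<in>V. \<bar>H i j c\<bar>) = 2"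
proof (rule ccontr)
  assume "\<not> ?thesis"
  then have "(\<Sum>c\<in>V. \<bar>H i j c\<bar>) = 0" using H_norm[OF assms(1-3)] by auto
  then have "\<And>c. c \<in> V \<Longrightarrow> H i j c = 0"
    using sum_nonneg_eq_0_iff[OF fin, of "\<lambda>c. \<bar>H i j c\<bar>"] by auto
  then show False using twin_if_zero assms by blast
qed

text \<open>An integer vector of norm at most 2 cannot take the same nonzero value three
  times.\<close>

lemma zero_if_const:
  assumes "i \<in> V" "j \<in> V" "i \<noteq> j" "R \<subseteq> V" "card R \<ge> 3"
    and const: "\<And>c c'. c \<in> R \<Longrightarrow> c' \<in> R \<Longrightarrow> c \<noteq> c' \<Longrightarrow> H i j c = H i j c'"
    and c: "c \<in> R"
  shows "H i j c = 0"
proof -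
  have "(\<Sum>c\<in>R. \<bar>H i j c\<bar>) \<le> (\<Sum>c\<in>V. \<bar>H i j c\<bar>)"
    using assms fin by (intro sum_mono2) auto
  moreover have "(\<Sum>c'\<in>R. \<bar>H i j c'\<bar>) = (\<Sum>c'\<in>R. \<bar>H i j c\<bar>)"
    using const c by (intro sum.cong refl) (metis)
  ultimately have le: "int (card R) * \<bar>H i j c\<bar> \<le> 2" using H_norm[OF assms(1-3)] by auto
  show ?thesis
  proof (rule ccontr)
    assume "H i j c \<noteq> 0"
    then have "int (card R) * 1 \<le> int (card R) * \<bar>H i j c\<bar>" by (intro mult_left_mono) auto
    then show False using le assms(5) by linarith
  qed
qed

text \<open>If \<open>|D\<^sub>i\<^sub>j f| = 1\<close> at some point then both values of \<open>f\<close> there are known, since \<open>f\<close> is Boolean. So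
  \<open>f\<close> is constant where \<open>x\<close> contains exactly one of \<open>i\<close>, \<open>j\<close> and follows the sign pattern of
  \<open>H i j\<close>, and \<open>D\<^sub>k\<^sub>l f\<close> has to vanish there.\<close>
lemma disjoint_pair_constraints:
  assumes ij: "i \<in> V" "j \<in> V" "i \<noteq> j" and nt: "\<not> tw i j"
    and kl: "k \<in> V" "l \<in> V" "k \<noteq> l" "k \<notin> {i, j}" "l \<notin> {i, j}" "H i j k = 0" "H i j l = 0"
  shows "\<And>c. c \<notin> {i, j} \<Longrightarrow> H i j c = 0 \<Longrightarrow> H k l c = 0"
    and "H k l i = H k l j"
    and "(\<Sum>c\<in>V. H k l c * H i j c) = 0"
proof -
  define h where "h = H i j"
  define g where "g = H k l"
  define S where "S = {c\<in>V. h c \<noteq> 0}"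
  define P where "P = {c\<in>V. h c > 0}"
  define R where "R = V - {i, j, k, l} - S"
  have n2: "(\<Sum>c\<in>V. \<bar>h c\<bar>) = 2" unfolding h_def using norm_two_if_not_twin[OF ij nt] .
  \<comment> \<open>All nonzero coefficients share one absolute value \<open>s\<close>, so on the
    support \<open>h\<close> is \<open>s\<close> times a sign pattern.\<close>
  obtain s where Ss: "card S \<le> 2" "\<And>c. c \<in> S \<Longrightarrow> \<bar>h c\<bar> = s"
  proof (rule abs_sum_two_cases[OF fin n2])
    fix a assume a: "a \<in> V" "\<bar>h a\<bar> = 2" "\<And>c. c \<in> V - {a} \<Longrightarrow> h c = 0"
    then have "S \<subseteq> {a}" unfolding S_def by auto
    then have "card S \<le> 1" using card_mono[of "{a}" S] by auto
    then show thesis using that[of 2] a \<open>S \<subseteq> {a}\<close> by auto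
  next
    fix a b assume a: "a \<in> V" "b \<in> V" "a \<noteq> b" "\<bar>h a\<bar> = 1" "\<bar>h b\<bar> = 1" "\<And>c. c \<in> V - {a, b} \<Longrightarrow> h c = 0"
    then have "S \<subseteq> {a, b}" unfolding S_def by auto
    then have "card S \<le> 2" using card_mono[of "{a, b}" S] a by auto
    then show thesis using that[of 1] a \<open>S \<subseteq> {a, b}\<close> by auto
  qed
  have PS: "P \<subseteq> S" "finite S" "finite P" "S \<subseteq> V" unfolding P_def S_def using fin by auto
  have cP: "card P \<le> card S" "card P \<le> 2" using card_mono[OF PS(2,1)] Ss by auto
  have hz: "h i = 0" "h j = 0" "h k = 0" "h l = 0" unfolding h_def using kl H_out by auto
  then have nS: "i \<notin> S" "j \<notin> S" "k \<notin> S" "l \<notin> S" unfolding S_def by auto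
  have "card (V - {i, j, k, l}) = 2 * w - 4" using ij kl cV fin by (subst card_Diff_subset) auto
  moreover have "S \<subseteq> V - {i, j, k, l}" using PS nS by auto
  ultimately have cR: "card R = 2 * w - 4 - card S" unfolding R_def using PS(2) by (simp add: card_Diff_subset)
  have finR: "finite R" unfolding R_def using fin by auto
  have val: "2 * (f (insert i z) - f (insert j z)) = 2"
    if z: "z \<in> slice (V - {i, j}) (w - 1)" "z \<inter> S = P" for z
  proof -
    have "lin (V - {i, j}) h z = (\<Sum>c\<in>V - {i, j}. \<bar>h c\<bar>)"
      unfolding lin_def
    proof (intro sum.cong refl)
      fix c assume c: "c \<in> V - {i, j}"
      have "c \<in> z \<longleftrightarrow> h c > 0" if "h c \<noteq> 0" using z that c unfolding S_def P_def by auto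
      then show "h c * sg c z = \<bar>h c\<bar>" unfolding sg_def by (cases "h c = 0") auto
    qed
    also have "\<dots> = (\<Sum>c\<in>V. \<bar>h c\<bar>)" using fin hz by (intro sum.mono_neutral_left) auto
    finally show ?thesis using H_lin[OF ij z(1)] n2 unfolding h_def by simp
  qed
  have val': "f x = (if i \<in> x then 1 else 0)"
    if x: "x \<in> slice V w" "x \<inter> S = P" "i \<in> x \<longleftrightarrow> j \<notin> x" for x
  proof -
    have fx: "finite x" using x fin slice_finite_mem by blast
    show ?thesis
    proof (cases "i \<in> x")
      case True
      have "x - {i} \<in> slice (V - {i, j}) (w - 1)" "(x - {i}) \<inter> S = P"
        using x True fx nS unfolding slice_def by auto
      then have "2 * (f (insert i (x - {i})) - f (insert j (x - {i}))) = 2" by (rule val)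
      moreover have "insert i (x - {i}) = x" using True by auto
      ultimately have "f x - f (insert j (x - {i})) = 1" by simp
      then show ?thesis using f01[of x] f01[of "insert j (x - {i})"] True by auto
    next
      case False
      have "x - {j} \<in> slice (V - {i, j}) (w - 1)" "(x - {j}) \<inter> S = P"
        using x False fx nS unfolding slice_def by auto
      then have "2 * (f (insert i (x - {j})) - f (insert j (x - {j}))) = 2" by (rule val)
      moreover have "insert j (x - {j}) = x" using False x by auto
      ultimately have "f (insert i (x - {j})) - f x = 1" by simp
      then show ?thesis using f01[of x] f01[of "insert i (x - {j})"] False by auto
    qed
  qed
  \<comment> \<open>Adding \<open>k\<close> or \<open>l\<close> does not disturb the pattern on
    \<open>S\<close>, \<open>i\<close> and \<open>j\<close>, so both values of \<open>f\<close> are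
    given by \<open>val'\<close>.\<close>
  have adm: "lin (V - {k, l}) g y = 0"
    if y: "y \<in> slice (V - {k, l}) (w - 1)" "y \<inter> S = P" "i \<in> y \<longleftrightarrow> j \<notin> y" for y
  proof -
    have "insert k y \<in> slice V w" "insert l y \<in> slice V w"
      using insert_in_slice[OF fin y(1)] kl w5 by auto
    then have "f (insert k y) = f (insert l y)" using val'[of "insert k y"] val'[of "insert l y"] y nS kl by auto
    then show ?thesis using H_lin[OF kl(1-3) y(1)] unfolding g_def by simp
  qed
  \<comment> \<open>Sets with the right trace on \<open>S\<close> are assembled from a prescribed
    part \<open>A\<close>, the positive support \<open>P\<close> and padding \<open>z\<close> from
    the free coordinates \<open>R\<close>.\<close>
  have ad: "A \<union> P \<union> z \<in> slice (V - {k, l}) (w - 1)" "(A \<union> P \<union> z) \<inter> S = P"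
    if "A \<subseteq> V - {k, l} - S" "finite A" "z \<in> slice (R - A) (w - 1 - card P - card A)" "card A \<le> 2" for A z
  proof -
    have zf: "finite z" "z \<subseteq> R - A" using that finR slice_finite_mem[of "R - A" z] unfolding slice_def by auto
    have "A \<inter> P = {}" "(A \<union> P) \<inter> z = {}" using that(1) PS(1) zf(2) unfolding R_def by auto
    then have "card (A \<union> P \<union> z) = card A + card P + card z"
      using card_Un_disjoint[of "A \<union> P" z] card_Un_disjoint[of A P] zf(1) PS(3) that(2) by simp
    then have "card (A \<union> P \<union> z) = w - 1" using that cP w5 unfolding slice_def by auto
    moreover have "A \<union> P \<union> z \<subseteq> V - {k, l}" using zf PS nS that unfolding R_def by auto
    ultimately show "A \<union> P \<union> z \<in> slice (V - {k, l}) (w - 1)" unfolding slice_def by auto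
    show "(A \<union> P \<union> z) \<inter> S = P" using zf PS that unfolding R_def by auto
  qed
  \<comment> \<open>Two such sets differing by an exchange of \<open>c\<close> and \<open>c'\<close>
    both annihilate the form, so \<open>g\<close> is constant on \<open>R\<close>. As
    \<open>R\<close> has at least three elements, the constant is 0.\<close>
  have gR: "g c = 0" if c: "c \<in> R" for c
  proof -
    have "g c = g c'" if cc: "c \<in> R" "c' \<in> R" "c \<noteq> c'" for c c'
    proof -
      have "card (R - {i, c, c'}) \<ge> card R - 2"
      proof -
        have "R - {i, c, c'} = R - {c, c'}" unfolding R_def by auto
        then show ?thesis using cc finR by (simp add: card_Diff_subset)
      qed
      then have "w - 1 - card P - 2 \<le> card (R - {i, c, c'})" using cR cP Ss w5 by linarith
      then obtain z where z: "z \<in> slice (R - {i, c, c'}) (w - 1 - card P - 2)"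
        using slice_nonempty finR by blast
      have "z \<in> slice (R - {i, c}) (w - 1 - card P - card {i, c})"
        "z \<in> slice (R - {i, c'}) (w - 1 - card P - card {i, c'})"
        using z cc unfolding slice_def R_def by auto
      moreover have "{i, c} \<subseteq> V - {k, l} - S" "{i, c'} \<subseteq> V - {k, l} - S"
        using cc ij kl nS unfolding R_def by auto
      ultimately have y: "{i, c} \<union> P \<union> z \<in> slice (V - {k, l}) (w - 1)" "({i, c} \<union> P \<union> z) \<inter> S = P"
        "{i, c'} \<union> P \<union> z \<in> slice (V - {k, l}) (w - 1)" "({i, c'} \<union> P \<union> z) \<inter> S = P"
        using ad[of "{i, c}" z] ad[of "{i, c'}" z] by (auto simp: card_insert_if)
      have jn: "j \<notin> {i, c} \<union> P \<union> z" "j \<notin> {i, c'} \<union> P \<union> z"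
        using z cc ij nS PS unfolding slice_def R_def by auto
      have "lin (V - {k, l}) g ({i, c} \<union> P \<union> z) = 0" "lin (V - {k, l}) g ({i, c'} \<union> P \<union> z) = 0"
        using adm[OF y(1,2)] adm[OF y(3,4)] jn by auto
      moreover have "{i, c} \<union> P \<union> z = insert c (insert i (P \<union> z))" "{i, c'} \<union> P \<union> z = insert c' (insert i (P \<union> z))"
        by auto
      moreover have "insert i (P \<union> z) \<subseteq> V - {k, l} - {c, c'}" "c \<in> V - {k, l}" "c' \<in> V - {k, l}"
        using y z cc PS unfolding slice_def R_def by auto
      ultimately show ?thesis
        using lin_swap[of "V - {k, l}" c c' "insert i (P \<union> z)" g] fin cc by simp
    qed
    moreover have "R \<subseteq> V" unfolding R_def by auto
    moreover have "card R \<ge> 3" using cR Ss w5 by linarith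
    ultimately show ?thesis using zero_if_const[OF kl(1-3), of R c] c unfolding g_def by blast
  qed
  show 1: "H k l c = 0" if "c \<notin> {i, j}" "H i j c = 0" for c
  proof (cases "c \<in> R")
    case True
    then show ?thesis using gR unfolding g_def by auto
  next
    case False
    then show ?thesis using that H_out[of c k l] unfolding R_def S_def h_def by auto
  qed
  \<comment> \<open>The same argument with \<open>i\<close> exchanged for \<open>j\<close> compares
    the coefficients there.\<close>
  have "w - 1 - card P - 1 \<le> card R" using cR cP Ss w5 by linarith
  then obtain z where z: "z \<in> slice R (w - 1 - card P - 1)" using slice_nonempty finR by blast
  have "R - {i} = R" "R - {j} = R" unfolding R_def by auto
  then have "z \<in> slice (R - {i}) (w - 1 - card P - card {i})" "z \<in> slice (R - {j}) (w - 1 - card P - card {j})"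
    using z by auto
  moreover have "{i} \<subseteq> V - {k, l} - S" "{j} \<subseteq> V - {k, l} - S" using ij kl nS by auto
  ultimately have y: "{i} \<union> P \<union> z \<in> slice (V - {k, l}) (w - 1)" "({i} \<union> P \<union> z) \<inter> S = P"
    "{j} \<union> P \<union> z \<in> slice (V - {k, l}) (w - 1)" "({j} \<union> P \<union> z) \<inter> S = P"
    using ad[of "{i}" z] ad[of "{j}" z] by auto
  have nin: "j \<notin> P \<union> z" "i \<notin> P \<union> z" using z nS PS unfolding slice_def R_def by auto
  have li: "lin (V - {k, l}) g ({i} \<union> P \<union> z) = 0" "lin (V - {k, l}) g ({j} \<union> P \<union> z) = 0"
    using adm[OF y(1,2)] adm[OF y(3,4)] nin ij by auto
  moreover have "P \<union> z \<subseteq> V - {k, l} - {i, j}" "i \<in> V - {k, l}" "j \<in> V - {k, l}"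
    using y nin ij kl unfolding slice_def by auto
  ultimately show gij: "H k l i = H k l j"
    using lin_swap[of "V - {k, l}" i j "P \<union> z" g] fin ij unfolding g_def by simp
  let ?y = "{i} \<union> P \<union> z"
  \<comment> \<open>At this point \<open>R\<close> contributes nothing and \<open>i\<close>,
    \<open>j\<close> enter with opposite signs and equal coefficients. What remains is a sum over
    \<open>S\<close> with the signs of \<open>h\<close>, which is the orthogonality relation up to
    the factor \<open>s\<close>.\<close>
  have "lin (V - {k, l}) g ?y = (\<Sum>c\<in>{i, j} \<union> S. g c * sg c ?y)"
    unfolding lin_def
  proof (rule sum.mono_neutral_right)
    show "{i, j} \<union> S \<subseteq> V - {k, l}" using ij kl nS PS by auto
    show "\<forall>c\<in>V - {k, l} - ({i, j} \<union> S). g c * sg c ?y = 0" using gR unfolding R_def by auto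
  qed (use fin in auto)
  also have "\<dots> = (\<Sum>c\<in>{i, j}. g c * sg c ?y) + (\<Sum>c\<in>S. g c * sg c ?y)"
    using nS PS by (intro sum.union_disjoint) auto
  also have "(\<Sum>c\<in>{i, j}. g c * sg c ?y) = 0"
    using ij nin gij unfolding g_def sg_def by auto
  finally have S0: "(\<Sum>c\<in>S. g c * sg c ?y) = 0" using li by simp
  have "(\<Sum>c\<in>V. g c * h c) = (\<Sum>c\<in>S. g c * h c)"
    using fin unfolding S_def by (intro sum.mono_neutral_right) auto
  also have "\<dots> = (\<Sum>c\<in>S. s * (g c * sg c ?y))"
  proof (intro sum.cong refl)
    fix c assume c: "c \<in> S"
    have "c \<in> ?y \<longleftrightarrow> h c > 0" using y(2) c PS(4) unfolding P_def by blast
    then have "h c = s * sg c ?y" using Ss(2)[OF c] unfolding sg_def by auto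
    then show "g c * h c = s * (g c * sg c ?y)" by simp
  qed
  also have "\<dots> = 0" using S0 by (simp add: sum_distrib_left[symmetric])
  finally show "(\<Sum>c\<in>V. H k l c * H i j c) = 0" unfolding g_def h_def .
qed

text \<open>The constraints make the three coefficient vectors pairwise orthogonal and squeeze them
  into so few coordinates that two nonzero ones leave no room for a third.\<close>

lemma not_twin_pair_isolates:
  assumes ij: "i \<in> V" "j \<in> V" "i \<noteq> j" and nt: "\<not> tw i j"
    and kl: "k \<in> V" "l \<in> V" "k \<noteq> l" "k \<notin> {i, j}" "l \<notin> {i, j}" "H i j k = 0" "H i j l = 0"
    and ntk: "\<not> tw k l"
    and kl': "k' \<in> V" "l' \<in> V" "k' \<noteq> l'" "k' \<notin> {i, j, k, l}" "l' \<notin> {i, j, k, l}" "H i j k' = 0" "H i j l' = 0"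
  shows "tw k' l'"
proof (rule twin_if_zero[OF kl'(1-3)])
  note c1 = disjoint_pair_constraints[OF ij nt kl]
  have "k' \<notin> {i, j}" "l' \<notin> {i, j}" "k' \<notin> {k, l}" "l' \<notin> {k, l}" using kl' by auto
  note c2 = disjoint_pair_constraints[OF ij nt kl'(1-3) this(1,2) kl'(6,7)]
  note c3 = disjoint_pair_constraints[OF kl(1-3) ntk kl'(1-3) \<open>k' \<notin> {k, l}\<close> \<open>l' \<notin> {k, l}\<close>
      c1(1)[OF \<open>k' \<notin> {i, j}\<close> kl'(6)] c1(1)[OF \<open>l' \<notin> {i, j}\<close> kl'(7)]]
  have ng: "(\<Sum>c\<in>V. \<bar>H k l c\<bar>) = 2" using norm_two_if_not_twin[OF kl(1-3) ntk] .
  have nh: "(\<Sum>c\<in>V. \<bar>H i j c\<bar>) = 2" using norm_two_if_not_twin[OF ij nt] .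
  have nk: "i \<notin> {k, l}" "j \<notin> {k, l}" using kl by auto
  have hkl: "H i j c = 0" if "c \<in> {k, l}" for c using that kl by auto
  \<comment> \<open>If \<open>c\<close> is \<open>k\<close> or \<open>l\<close>, the constraint from
    the pair \<open>i\<close>, \<open>j\<close> applies; otherwise the one from \<open>k\<close>,
    \<open>l\<close> does.\<close>
  have big: "H k' l' c = 0" if c: "c \<in> V" "c \<notin> {i, j}" "H k l c = 0" for c
    using c c2(1)[of c] c3(1)[of c] hkl[of c] by blast
  fix c assume cV: "c \<in> V"
  show "H k' l' c = 0"
  proof (cases "H k l i = 0")
    case False
    \<comment> \<open>Norm 2 confines \<open>H k l\<close> to \<open>{i, j}\<close>, where both
      vectors have equal entries; orthogonality then removes \<open>H k' l'\<close>.\<close>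
    then have gi: "H k l i \<noteq> 0" "H k l j \<noteq> 0" using c1(2) by auto
    have "(\<Sum>c\<in>V - {i, j}. \<bar>H k l c\<bar>) = 2 - \<bar>H k l i\<bar> - \<bar>H k l j\<bar>"
      using sum.subset_diff[of "{i, j}" V "\<lambda>c. \<bar>H k l c\<bar>"] ij fin ng by simp
    moreover have "(\<Sum>c\<in>V - {i, j}. \<bar>H k l c\<bar>) \<ge> 0" by (intro sum_nonneg) auto
    ultimately have "(\<Sum>c\<in>V - {i, j}. \<bar>H k l c\<bar>) = 0" using gi by linarith
    then have z: "H k l c = 0" if "c \<in> V - {i, j}" for c
      using sum_nonneg_eq_0_iff[of "V - {i, j}" "\<lambda>c. \<bar>H k l c\<bar>"] fin that by auto
    have "(\<Sum>c\<in>V. H k' l' c * H k l c) = H k' l' i * H k l i + H k' l' j * H k l j"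
      using z by (intro sum_pair[OF fin ij]) auto
    then have "H k' l' i * H k l i = 0" using c3(3) c1(2) c2(2) by auto
    then have "H k' l' i = 0" "H k' l' j = 0" using gi c2(2) by auto
    then show ?thesis using big[of c] z[of c] cV by blast
  next
    case True
    \<comment> \<open>Now everything lives on the support of \<open>H i j\<close>. One coordinate is
      too few even for \<open>H k l\<close>; in a plane, two nonzero orthogonal vectors force the
      third to be 0.\<close>
    then have "H k' l' i = 0" "H k' l' j = 0" using c3(1)[OF nk(1)] c2(2) by auto
    moreover have "H k' l' c = 0" if "c \<notin> {i, j}"
    proof (rule abs_sum_two_cases[OF fin nh])
      fix a assume a: "a \<in> V" "\<bar>H i j a\<bar> = 2" "\<And>c. c \<in> V - {a} \<Longrightarrow> H i j c = 0"
      have "(\<Sum>c\<in>V. H k l c * H i j c) = (\<Sum>c\<in>{a}. H k l c * H i j c)"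
        using a fin by (intro sum.mono_neutral_right) auto
      then have "H k l a = 0" using c1(3) a by auto
      then show ?thesis using big[of c] c1(1)[of c] a(3)[of c] that cV by blast
    next
      fix a b assume a: "a \<in> V" "b \<in> V" "a \<noteq> b" "\<bar>H i j a\<bar> = 1" "\<bar>H i j b\<bar> = 1"
        "\<And>c. c \<in> V - {a, b} \<Longrightarrow> H i j c = 0"
      have ab: "a \<notin> {i, j}" "b \<notin> {i, j}" using a H_out[of a i j] H_out[of b i j] by auto
      have z: "H k l c = 0" if "c \<in> V - {a, b}" for c
        using c1 that True a(6) by (metis insert_iff empty_iff)
      have p1: "H k l a * H i j a + H k l b * H i j b = 0"
        using sum_pair[OF fin a(1-3), of "\<lambda>c. H k l c * H i j c"] a(6) c1(3) by simp
      have p2: "H k' l' a * H i j a + H k' l' b * H i j b = 0"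
        using sum_pair[OF fin a(1-3), of "\<lambda>c. H k' l' c * H i j c"] a(6) c2(3) by simp
      have p3: "H k' l' a * H k l a + H k' l' b * H k l b = 0"
        using sum_pair[OF fin a(1-3), of "\<lambda>c. H k' l' c * H k l c"] z c3(3) by simp
      have p4: "\<bar>H k l a\<bar> + \<bar>H k l b\<bar> = 2"
        using sum_pair[OF fin a(1-3), of "\<lambda>c. \<bar>H k l c\<bar>"] z ng by simp
      have sq: "H i j a = 1 \<or> H i j a = - 1" "H i j b = 1 \<or> H i j b = - 1" using a(4,5) by linarith+
      have r: "H k l b = H k l a \<or> H k l b = - H k l a" using sq p1 by auto
      have r': "H k l b = H k l a \<longrightarrow> H k' l' b = H k' l' a" "H k l b = - H k l a \<longrightarrow> H k' l' b = - H k' l' a"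
        using sq p1 p2 p4 by auto
      have nz: "H k l a \<noteq> 0" using r p4 by auto
      have "2 * (H k' l' a * H k l a) = 0" using r r' p3 by auto
      then have "H k' l' a = 0" using nz by auto
      moreover from this have "H k' l' b = 0" using r r' by auto
      ultimately show ?thesis using big[of c] z[of c] that cV by blast
    qed
    ultimately show ?thesis by blast
  qed
qed

text \<open>Discarding a non-twin pair and the support of its vector costs at most four coordinates.
  In the rest \<open>K\<close>, any non-twin pair makes all coordinates outside it twins, so one
  further deletion suffices.\<close>

lemma large_twin_set:
  "\<exists>T\<subseteq>V. card T + 5 \<ge> 2 * w \<and> (\<forall>i\<in>T. \<forall>j\<in>T. i \<noteq> j \<longrightarrow> tw i j)"
proof (cases "\<forall>i\<in>V. \<forall>j\<in>V. i \<noteq> j \<longrightarrow> tw i j")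
  case True
  then show ?thesis using cV by (intro exI[of _ V]) auto
next
  case False
  then obtain i j where ij: "i \<in> V" "j \<in> V" "i \<noteq> j" and nt: "\<not> tw i j" by auto
  define K where "K = V - {i, j} - {c\<in>V. H i j c \<noteq> 0}"
  have "card {c\<in>V. H i j c \<noteq> 0} \<le> 2"
  proof (rule abs_sum_two_cases[OF fin norm_two_if_not_twin[OF ij nt]])
    fix a assume "\<And>c. c \<in> V - {a} \<Longrightarrow> H i j c = 0"
    then have "{c\<in>V. H i j c \<noteq> 0} \<subseteq> {a}" by auto
    then show ?thesis using card_mono[of "{a}" "{c\<in>V. H i j c \<noteq> 0}"] by simp
  next
    fix a b assume "a \<noteq> b" "\<And>c. c \<in> V - {a, b} \<Longrightarrow> H i j c = 0"
    then have "{c\<in>V. H i j c \<noteq> 0} \<subseteq> {a, b}" by auto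
    then show ?thesis using card_mono[of "{a, b}" "{c\<in>V. H i j c \<noteq> 0}"] \<open>a \<noteq> b\<close> by auto
  qed
  then have cK: "card K + 4 \<ge> 2 * w"
    using diff_card_le_card_Diff[of "{c\<in>V. H i j c \<noteq> 0}" "V - {i, j}"] fin ij cV unfolding K_def by auto
  have KV: "K \<subseteq> V" unfolding K_def by auto
  have iso: "tw k' l'" if "k \<in> K" "l \<in> K" "k \<noteq> l" "\<not> tw k l" "k' \<in> K - {k, l}" "l' \<in> K - {k, l}" "k' \<noteq> l'" for k l k' l'
    using that not_twin_pair_isolates[OF ij nt, of k l k' l'] unfolding K_def by auto
  show ?thesis
  proof (cases "\<forall>i\<in>K. \<forall>j\<in>K. i \<noteq> j \<longrightarrow> tw i j")
    case True
    then show ?thesis using cK KV by (intro exI[of _ K]) auto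
  next
    case False
    then obtain k l where kl: "k \<in> K" "l \<in> K" "k \<noteq> l" "\<not> tw k l" by auto
    have finK: "finite K" using KV fin finite_subset by auto
    have "card (K - {k, l}) \<ge> 2" using cK w5 kl finK by (simp add: card_Diff_subset)
    then obtain r r' where r: "r \<in> K - {k, l}" "r' \<in> K - {k, l}" "r \<noteq> r'"
      by (metis One_nat_def Suc_1 card_le_Suc0_iff_eq finK finite_Diff not_less_eq_eq)
    \<comment> \<open>If \<open>k\<close> is a twin of neither \<open>l\<close> nor
      \<open>r\<close>, then \<open>{k, r}\<close> settles all pairs avoiding \<open>r\<close> and
      \<open>{k, l}\<close> all pairs avoiding \<open>l\<close>; the pair \<open>l\<close>,
      \<open>r\<close> is linked through \<open>r'\<close>.\<close>
    have key: "\<exists>T\<subseteq>V. card T + 5 \<ge> 2 * w \<and> (\<forall>i\<in>T. \<forall>j\<in>T. i \<noteq> j \<longrightarrow> tw i j)"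
      if kl: "k \<in> K" "l \<in> K" "k \<noteq> l" "\<not> tw k l" and r: "r \<in> K - {k, l}" "r' \<in> K - {k, l}" "r \<noteq> r'"
        and nkr: "\<not> tw k r" for k l
    proof (intro exI[of _ "K - {k}"] conjI ballI impI)
      show "K - {k} \<subseteq> V" using KV by auto
      show "2 * w \<le> card (K - {k}) + 5" using cK kl finK w5 by (simp add: card_Diff_singleton)
      fix p q assume pq: "p \<in> K - {k}" "q \<in> K - {k}" "p \<noteq> q"
      have a: "tw p q" if "p \<in> K - {k, r}" "q \<in> K - {k, r}" "p \<noteq> q" for p q
        using iso[of k r p q] kl r nkr that by auto
      have b: "tw p q" if "p \<in> K - {k, l}" "q \<in> K - {k, l}" "p \<noteq> q" for p q
        using iso[of k l p q] kl that by auto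
      have "tw l r'" "tw r' r" using a[of l r'] b[of r' r] kl r by auto
      then have lr: "tw l r" using twin_trans[OF fin, of l r r'] kl r KV by auto
      show "tw p q"
      proof (cases "p \<noteq> r \<and> q \<noteq> r")
        case True then show ?thesis using a pq by auto
      next
        case False
        show ?thesis
        proof (cases "p \<noteq> l \<and> q \<noteq> l")
          case True then show ?thesis using b pq by auto
        next
          case F2: False
          then have "(p = l \<and> q = r) \<or> (p = r \<and> q = l)" using False pq r by auto
          then show ?thesis using lr twin_sym[OF lr] by auto
        qed
      qed
    qed
    \<comment> \<open>By transitivity \<open>r\<close> cannot be a twin of both \<open>k\<close> and
      \<open>l\<close>; the one that fails is deleted.\<close>
    have "\<not> tw k r \<or> \<not> tw r l" using twin_trans[OF fin, of k l r "w - 1" f] kl r KV by auto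
    then show ?thesis
    proof
      assume "\<not> tw k r" then show ?thesis using key[OF kl r] by auto
    next
      assume "\<not> tw r l"
      then have "\<not> tw l r" "\<not> tw l k" using twin_sym[of V "w - 1" f l] kl by auto
      then show ?thesis using key[of l k] kl r by (simp add: insert_commute)
    qed
  qed
qed

end

subsection \<open>Boolean quadratic functions\<close>

context slice_boolean
begin

text \<open>\<open>F\<close> does not see a coordinate \<open>t\<close> of \<open>T\<close>, so the
  difference of \<open>f\<close> in \<open>i\<close> and \<open>t\<close> is the derivative of
  \<open>F\<close> in direction \<open>i\<close>. Its linear form has no coefficients on
  \<open>T\<close>.\<close>

lemma diff_of_junta:
  assumes TV: "T \<subseteq> V" and cT: "card T + 5 \<ge> 2 * w"
    and tT: "\<And>i j. i \<in> T \<Longrightarrow> j \<in> T \<Longrightarrow> i \<noteq> j \<Longrightarrow> tw i j"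
    and F: "\<And>x. x \<in> slice V w \<Longrightarrow> f x = F (x - T)"
    and i: "i \<in> V - T"
  shows "(\<forall>y\<subseteq>V - T - {i}. F (insert i y) = F y) \<or>
    (\<exists>a\<in>V - T - {i}. \<exists>b\<in>V - T - {i}. \<exists>e e'. \<bar>e\<bar> = 1 \<and> \<bar>e'\<bar> = 1 \<and> (a = b \<longrightarrow> e = e') \<and>
       (\<forall>y\<subseteq>V - T - {i}. 2 * (F (insert i y) - F y) = e * sg a y + e' * sg b y))"
proof -
  have fT: "finite T" using TV fin finite_subset by auto
  have "T \<noteq> {}" using cT w5 by auto
  then obtain t where t: "t \<in> T" by auto
  have it: "i \<in> V" "t \<in> V" "i \<noteq> t" using i t TV by auto
  define h where "h = H i t"
  \<comment> \<open>Exchanging the twins \<open>s\<close> and \<open>s'\<close> changes neither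
    value of \<open>f\<close> in the difference, so their coefficients agree.\<close>
  have cc: "h s = h s'" if ss: "s \<in> T - {t}" "s' \<in> T - {t}" "s \<noteq> s'" for s s'
  proof -
    have "V - {i, t} - {s, s'} = V - {i, t, s, s'}" by auto
    moreover have "s \<in> V" "s' \<in> V" "s \<noteq> i" "s' \<noteq> i" "s \<noteq> t" "s' \<noteq> t" using ss i TV by auto
    then have "card (V - {i, t, s, s'}) = 2 * w - 4" using it ss(3) cV fin by (subst card_Diff_subset) auto
    ultimately have "card (V - {i, t} - {s, s'}) = 2 * w - 4" by simp
    then have "w - 2 \<le> card (V - {i, t} - {s, s'})" using w5 by linarith
    then obtain z where z: "z \<in> slice (V - {i, t} - {s, s'}) (w - 2)"
      using slice_nonempty[of "V - {i, t} - {s, s'}" "w - 2"] fin by blast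
    have fz: "finite z" "z \<subseteq> V - {i, t} - {s, s'}" "card z = w - 2"
      using z fin slice_finite_mem[of _ z] unfolding slice_def by auto
    have sw: "insert s z \<in> slice (V - {i, t}) (w - 1)" "insert s' z \<in> slice (V - {i, t}) (w - 1)"
      "insert i z \<in> slice (V - {s, s'}) (w - 1)" "insert t z \<in> slice (V - {s, s'}) (w - 1)"
      using fz ss it TV i w5 unfolding slice_def by (auto simp: card_insert_if)
    have "tw s s'" using tT ss by auto
    then have "f (insert s (insert i z)) = f (insert s' (insert i z))"
      "f (insert s (insert t z)) = f (insert s' (insert t z))" using sw unfolding twin_def by blast+
    then have "lin (V - {i, t}) h (insert s z) = lin (V - {i, t}) h (insert s' z)"
      using H_lin[OF it sw(1)] H_lin[OF it sw(2)] unfolding h_def by (simp add: insert_commute)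
    then show ?thesis using lin_swap[of "V - {i, t}" s s' z h] fz ss i TV fin by auto
  qed
  have "card (T - {t}) \<ge> 3" using cT w5 t fT by (simp add: card_Diff_singleton)
  then have hT: "h c = 0" if "c \<in> T" for c
    using zero_if_const[OF it, of "T - {t}" c] cc TV that H_out[of c i t] unfolding h_def by blast
  let ?U = "V - T - {i}"
  have cK: "card (V - T) \<le> 5" using cT TV cV fT fin by (simp add: card_Diff_subset)
  have form: "2 * (F (insert i y) - F y) = (\<Sum>c\<in>?U. h c * sg c y)" if y: "y \<subseteq> ?U" for y
  proof -
    have fy: "finite y" using y fin finite_subset by (metis finite_Diff)
    have "insert i y \<subseteq> V - T" "i \<notin> y" using y i by auto
    then have cy: "card y \<le> 4" using card_mono[of "V - T" "insert i y"] fin cK fy by simp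
    \<comment> \<open>Any trace \<open>y\<close> has at most four elements and can be padded from
      \<open>T - {t}\<close> to size \<open>w - 1\<close>.\<close>
    have "w - 1 - card y \<le> card (T - {t})" using cT t fT w5 by (simp add: card_Diff_singleton)
    then obtain Y where Y: "Y \<in> slice (T - {t}) (w - 1 - card y)" using slice_nonempty fT by blast
    have YT: "Y \<subseteq> T - {t}" "finite Y" "card Y = w - 1 - card y"
      using Y fT slice_finite_mem[of "T - {t}" Y] unfolding slice_def by auto
    have "card (y \<union> Y) = card y + card Y" using fy YT y by (intro card_Un_disjoint) auto
    then have cyY: "card (y \<union> Y) = w - 1" using YT cy w5 by simp
    then have x: "y \<union> Y \<in> slice (V - {i, t}) (w - 1)" using y YT TV i t unfolding slice_def by auto
    have "insert i (y \<union> Y) \<in> slice V w" "insert t (y \<union> Y) \<in> slice V w"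
      using insert_in_slice[OF fin x] it w5 by auto
    moreover have "insert i (y \<union> Y) - T = insert i y" "insert t (y \<union> Y) - T = y" using y YT i t by auto
    ultimately have "2 * (F (insert i y) - F y) = lin (V - {i, t}) h (y \<union> Y)"
      using H_lin[OF it x] F unfolding h_def by metis
    also have "\<dots> = (\<Sum>c\<in>?U. h c * sg c (y \<union> Y))"
      unfolding lin_def using fin t hT by (intro sum.mono_neutral_right) auto
    also have "\<dots> = (\<Sum>c\<in>?U. h c * sg c y)" using YT by (intro sum.cong) (auto simp: sg_def)
    finally show ?thesis .
  qed
  have "(\<Sum>c\<in>V. \<bar>h c\<bar>) = (\<Sum>c\<in>?U. \<bar>h c\<bar>)"
    using fin hT H_out[of i i t] unfolding h_def by (intro sum.mono_neutral_right) auto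
  then have "(\<Sum>c\<in>?U. \<bar>h c\<bar>) \<in> {0, 2}" using H_norm[OF it] unfolding h_def by simp
  then consider "(\<Sum>c\<in>?U. \<bar>h c\<bar>) = 0" | "(\<Sum>c\<in>?U. \<bar>h c\<bar>) = 2" by auto
  then show ?thesis
  proof cases
    case 1
    then have "h c = 0" if "c \<in> ?U" for c
      using sum_nonneg_eq_0_iff[of ?U "\<lambda>c. \<bar>h c\<bar>"] fin that by auto
    then have "F (insert i y) = F y" if "y \<subseteq> ?U" for y using form[OF that] by simp
    then show ?thesis by blast
  next
    case 2
    have fU: "finite ?U" using fin by simp
    show ?thesis
    proof (rule abs_sum_two_cases[OF fU 2])
      fix a assume a: "a \<in> ?U" "\<bar>h a\<bar> = 2" "\<And>c. c \<in> ?U - {a} \<Longrightarrow> h c = 0"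
      \<comment> \<open>A single coefficient of absolute value 2 is recorded as \<open>a = b\<close>
        with equal signs.\<close>
      define e :: int where "e = (if h a > 0 then 1 else - 1)"
      have "2 * (F (insert i y) - F y) = e * sg a y + e * sg a y" if "y \<subseteq> ?U" for y
      proof -
        have "(\<Sum>c\<in>?U. h c * sg c y) = (\<Sum>c\<in>{a}. h c * sg c y)"
          using a fU by (intro sum.mono_neutral_right) auto
        moreover have "h a = 2 * e" using a(2) unfolding e_def by auto
        ultimately show ?thesis using form[OF that] by simp
      qed
      moreover have "\<bar>e\<bar> = 1" unfolding e_def by auto
      ultimately show ?thesis using a(1) by blast
    next
      fix a b assume a: "a \<in> ?U" "b \<in> ?U" "a \<noteq> b" "\<bar>h a\<bar> = 1" "\<bar>h b\<bar> = 1" "\<And>c. c \<in> ?U - {a, b} \<Longrightarrow> h c = 0"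
      have "2 * (F (insert i y) - F y) = h a * sg a y + h b * sg b y" if "y \<subseteq> ?U" for y
        using form[OF that] sum_pair[OF fU a(1-3), of "\<lambda>c. h c * sg c y"] a(6) by simp
      then show ?thesis using a by blast
    qed
  qed
qed

end

text \<open>The variable \<open>a\<close> selects, together with \<open>b\<close>, which of \<open>i\<close>, \<open>q\<close> is compared with \<open>a\<close>. The first
  branch comes from the derivative in direction \<open>i\<close>; knowing it, the derivative in direction \<open>a\<close> must
  contain \<open>i\<close> with a known sign, and its remaining variable is \<open>q\<close>.\<close>
lemma boolean_quadratic_cases:
  fixes F :: "'a set \<Rightarrow> int"
  assumes F01: "\<And>y. y \<subseteq> K \<Longrightarrow> F y \<in> {0, 1}"
    and D: "\<And>i. i \<in> K \<Longrightarrow> (\<forall>y\<subseteq>K - {i}. F (insert i y) = F y) \<or>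
      (\<exists>a\<in>K - {i}. \<exists>b\<in>K - {i}. \<exists>e e'. \<bar>e\<bar> = 1 \<and> \<bar>e'\<bar> = 1 \<and> (a = b \<longrightarrow> e = e') \<and>
       (\<forall>y\<subseteq>K - {i}. 2 * (F (insert i y) - F y) = e * sg a y + e' * sg b y))"
    and nc: "i \<in> K" "y0 \<subseteq> K - {i}" "F (insert i y0) \<noteq> F y0"
  obtains a e where "a \<in> K" "a \<noteq> i" "\<And>y. y \<subseteq> K \<Longrightarrow> F y = 1 \<longleftrightarrow> ((i \<in> y) = (a \<in> y)) = e"
  | a b q e1 e2 e3 where "a \<in> K" "b \<in> K" "q \<in> K" "distinct [i, a, b]" "q \<notin> {i, a}"
     "\<And>y. y \<subseteq> K \<Longrightarrow> F y = 1 \<longleftrightarrow> (if ((a \<in> y) = (b \<in> y)) = e1 then ((i \<in> y) = (a \<in> y)) = e2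
                                                          else ((q \<in> y) = (a \<in> y)) = e3)"
proof -
  obtain a b e e' where ab: "a \<in> K - {i}" "b \<in> K - {i}" "\<bar>e\<bar> = 1" "\<bar>e'\<bar> = 1" "a = b \<longrightarrow> e = e'"
    and Di: "\<And>y. y \<subseteq> K - {i} \<Longrightarrow> 2 * (F (insert i y) - F y) = e * sg a y + e' * sg b y"
    using D[OF nc(1)] nc(2,3) by blast
  have e: "e = 1 \<or> e = - 1" "e' = 1 \<or> e' = - 1" using ab(3,4) by linarith+
  have step: "(i \<in> y \<longrightarrow> insert i (y - {i}) = y) \<and> (i \<notin> y \<longrightarrow> y - {i} = y)" for y by auto
  have sq: "sg c y = 1 \<or> sg c y = - 1" for c y unfolding sg_def by auto
  \<comment> \<open>Where the two terms agree, the derivative in direction \<open>i\<close> is 1 or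
    -1, which fixes both Boolean values.\<close>
  have f1: "2 * F y = 1 + e * (sg i y * sg a y)"
    if y: "y \<subseteq> K" "((a \<in> y) = (b \<in> y)) = (e = e')" for y
  proof -
    define X where "X = F (insert i (y - {i}))"
    define Z where "Z = F (y - {i})"
    have z: "y - {i} \<subseteq> K - {i}" "insert i (y - {i}) \<subseteq> K" "y - {i} \<subseteq> K" using y nc by auto
    have s: "sg a (y - {i}) = sg a y" "sg b (y - {i}) = sg b y" using ab unfolding sg_def by auto
    have ss: "e * sg a y = e' * sg b y" using y e unfolding sg_def by auto
    have "2 * (X - Z) = 2 * (e * sg a y)" unfolding X_def Z_def using Di[OF z(1)] s ss by simp
    moreover have "e * sg a y = 1 \<or> e * sg a y = - 1" using e(1) sq[of a y] by auto
    moreover have "X = 0 \<or> X = 1" "Z = 0 \<or> Z = 1" unfolding X_def Z_def using F01[OF z(2)] F01[OF z(3)] by blast+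
    ultimately have "2 * X = 1 + e * sg a y" "2 * Z = 1 - e * sg a y" by auto
    moreover have "F y = (if i \<in> y then X else Z)" unfolding X_def Z_def using step[of y] by metis
    moreover have "sg i y = (if i \<in> y then 1 else - 1)" unfolding sg_def by simp
    ultimately show ?thesis by simp
  qed
  have f2: "F (insert i z) = F z" if z: "z \<subseteq> K - {i}" "((a \<in> z) = (b \<in> z)) \<noteq> (e = e')" for z
  proof -
    have "e * sg a z + e' * sg b z = 0" using z(2) e unfolding sg_def by auto
    then show ?thesis using Di[OF z(1)] by simp
  qed
  have fin: "F y = 1 \<longleftrightarrow> ((p \<in> y) = (q \<in> y)) = (c = 1)"
    if "2 * F y = 1 + c * (sg p y * sg q y)" "c = 1 \<or> c = - 1" for p q y and c :: int
    using that unfolding sg_def by (auto split: if_splits)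
  show thesis
  proof (cases "a = b")
    case True
    have "F y = 1 \<longleftrightarrow> ((i \<in> y) = (a \<in> y)) = (e = 1)" if "y \<subseteq> K" for y
      using fin[OF f1[OF that] e(1)] ab(5) True by auto
    then show ?thesis using that(1)[of a] ab by auto
  next
    case False
    \<comment> \<open>The set \<open>z\<close> is chosen so that the two terms cancel at
      \<open>z\<close> but agree once \<open>a\<close> is added. The mixed difference in
      \<open>a\<close> and \<open>i\<close> is then \<open>e\<close>.\<close>
    define z where "z = (if e = e' then {b} else {})"
    have z: "z \<subseteq> K - {i}" "z \<subseteq> K - {a}" "insert i z \<subseteq> K - {a}" "a \<notin> z" "b \<in> z \<longleftrightarrow> e = e'" "i \<notin> z"
      using ab False nc unfolding z_def by auto
    have Fz: "F (insert i z) = F z" by (rule f2[OF z(1)]) (use z(4,5) in simp)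
    have iz: "insert a z \<subseteq> K" "insert a (insert i z) \<subseteq> K" using z ab nc by auto
    have "2 * F (insert a z) = 1 - e" "2 * F (insert a (insert i z)) = 1 + e"
      using f1[OF iz(1)] f1[OF iz(2)] z(4-6) False ab by (auto simp: sg_def)
    then have Fa: "F (insert a (insert i z)) - F (insert a z) = e" by simp
    have "F (insert a (insert i z)) - F (insert i z) \<noteq> F (insert a z) - F z" using Fa Fz e(1) by linarith
    then have "\<not> (\<forall>y\<subseteq>K - {a}. F (insert a y) = F y)" using z(2,3) by (metis diff_self)
    then obtain p q d d' where pq: "p \<in> K - {a}" "q \<in> K - {a}" "\<bar>d\<bar> = 1" "\<bar>d'\<bar> = 1"
      and Da: "\<And>y. y \<subseteq> K - {a} \<Longrightarrow> 2 * (F (insert a y) - F y) = d * sg p y + d' * sg q y"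
      using D[of a] ab by blast
    have d: "d = 1 \<or> d = - 1" "d' = 1 \<or> d' = - 1" using pq(3,4) by linarith+
    have "d * (sg p (insert i z) - sg p z) + d' * (sg q (insert i z) - sg q z) = 2 * e"
      using Da[OF z(2)] Da[OF z(3)] Fa Fz by (simp add: algebra_simps)
    moreover have "sg c (insert i z) - sg c z = (if c = i then 2 else 0)" for c
      using z unfolding sg_def by auto
    ultimately have "d * (if p = i then 2 else 0) + d' * (if q = i then 2 else 0) = 2 * e" by simp
    \<comment> \<open>Both variables being \<open>i\<close> would make the left side a multiple of
      4, so exactly one is \<open>i\<close>, with coefficient \<open>e\<close>.\<close>
    then have cs: "(p = i \<and> q \<noteq> i \<and> d = e) \<or> (q = i \<and> p \<noteq> i \<and> d' = e)"
      using e d by (cases "p = i"; cases "q = i") auto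
    obtain r g where r: "r \<in> K - {a}" "r \<noteq> i" "\<bar>g\<bar> = 1"
      and Dr: "\<And>y. y \<subseteq> K - {a} \<Longrightarrow> 2 * (F (insert a y) - F y) = e * sg i y + g * sg r y"
    proof (cases "p = i \<and> q \<noteq> i \<and> d = e")
      case True
      then show ?thesis using that[of q d'] pq Da by auto
    next
      case False
      then have "q = i" "p \<noteq> i" "d' = e" using cs by auto
      then show ?thesis using that[of p d] pq Da by (auto simp: add.commute)
    qed
    have g: "g = 1 \<or> g = - 1" using r(3) by linarith
    \<comment> \<open>Flipping \<open>a\<close> leads into the other branch, where \<open>f1\<close>
      gives the value; the derivative in direction \<open>a\<close> carries it back.\<close>
    have f3: "2 * F y = 1 + g * (sg r y * sg a y)"
      if y: "y \<subseteq> K" "((a \<in> y) = (b \<in> y)) \<noteq> (e = e')" for y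
    proof (cases "a \<in> y")
      case True
      define u where "u = y - {a}"
      have u: "y = insert a u" "a \<notin> u" "u \<subseteq> K - {a}" "u \<subseteq> K" using True y unfolding u_def by auto
      have "2 * F u = 1 + e * (sg i u * sg a u)" using f1[OF u(4)] y(2) u(1,2) False by auto
      moreover have "sg a u = - 1" "sg a y = 1" "sg r y = sg r u" using u r unfolding sg_def by auto
      moreover have "2 * (F y - F u) = e * sg i u + g * sg r u" using Dr[OF u(3)] u(1) by simp
      ultimately show ?thesis by simp
    next
      case F: False
      have u: "y \<subseteq> K - {a}" "insert a y \<subseteq> K" using F y ab by auto
      have "2 * F (insert a y) = 1 + e * (sg i (insert a y) * sg a (insert a y))"
        using f1[OF u(2)] y(2) F False by auto
      moreover have "sg a (insert a y) = 1" "sg a y = - 1" "sg i (insert a y) = sg i y" using F ab unfolding sg_def by auto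
      ultimately show ?thesis using Dr[OF u(1)] by simp
    qed
    show ?thesis
    proof (rule that(2)[of a b r "e = e'" "e = 1" "g = 1"])
      fix y assume "y \<subseteq> K"
      then show "F y = 1 \<longleftrightarrow> (if ((a \<in> y) = (b \<in> y)) = (e = e') then ((i \<in> y) = (a \<in> y)) = (e = 1)
                                                          else ((r \<in> y) = (a \<in> y)) = (g = 1))"
        using fin[OF f1[of y] e(1)] fin[OF f3[of y] g] by presburger
    qed (use ab r False in auto)
  qed
qed

subsection \<open>Equitable partitions\<close>

lemma permutes_extending_list:
  assumes "finite S"
  shows "distinct xs \<Longrightarrow> distinct ys \<Longrightarrow> length xs = length ys \<Longrightarrow> set xs \<subseteq> S \<Longrightarrow> set ys \<subseteq> S \<Longrightarrow>
    \<exists>\<pi>. \<pi> permutes S \<and> map \<pi> xs = ys"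
proof (induction xs arbitrary: ys)
  case Nil
  then show ?case using permutes_id[of S] by (metis length_0_conv list.map(1) list.size(3))
next
  case (Cons x xs)
  then obtain y ys' where ys: "ys = y # ys'" by (cases ys) auto
  obtain \<pi> where p: "\<pi> permutes S" "map \<pi> xs = ys'" using Cons.IH[of ys'] Cons.prems ys by auto
  define \<rho> where "\<rho> = transpose (\<pi> x) y \<circ> \<pi>"
  have "\<pi> x \<in> S" using p(1) Cons.prems by (simp add: permutes_in_image)
  then have "\<rho> permutes S" unfolding \<rho>_def
    using p(1) Cons.prems ys by (intro permutes_compose permutes_swap_id) auto
  moreover have "\<rho> x = y" unfolding \<rho>_def by simp
  moreover have "map \<rho> xs = ys'"
  proof -
    have "\<rho> z = \<pi> z" if "z \<in> set xs" for z
    proof -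
      have "\<pi> z \<noteq> \<pi> x" using that Cons.prems permutes_inj[OF p(1)] by (auto dest: injD)
      moreover have "\<pi> z \<in> set ys'" using that p(2) by auto
      then have "\<pi> z \<noteq> y" using Cons.prems ys by auto
      ultimately show ?thesis unfolding \<rho>_def by (simp add: transpose_apply_other)
    qed
    then show ?thesis using p(2) by auto
  qed
  ultimately show ?case using ys by auto
qed

lemma slice_johnson: "johnson_vertices n w = slice {0..<n} w"
  unfolding johnson_vertices_def slice_def by simp

text \<open>\<open>\<Phi>\<close> is a Boolean pattern read at the coordinates \<open>ks\<close> of
  the model and at \<open>es\<close> of the given partition; \<open>s\<close> tells whether
  \<open>C1\<close> matches the first or the second cell.\<close>

lemma equivalent_partitionsI:
  assumes "distinct es" "distinct ks" "length es = length ks" "set es \<subseteq> {0..<2 * w}" "set ks \<subseteq> {0..<2 * w}"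
    and P: "\<And>x. x \<in> johnson_vertices (2 * w) w \<Longrightarrow> x \<in> P_cell1 k w \<longleftrightarrow> \<Phi> (map (\<lambda>e. e \<in> x) ks)"
    and C: "\<And>x. x \<in> johnson_vertices (2 * w) w \<Longrightarrow> x \<in> C1 \<longleftrightarrow> \<Phi> (map (\<lambda>e. e \<in> x) es) = s"
  shows "equivalent_partitions (2 * w) w (C1, C2) (P_part k w)"
proof -
  obtain \<pi> where p: "\<pi> permutes {0..<2 * w}" "map \<pi> es = ks"
    using permutes_extending_list[of "{0..<2 * w}" es ks] assms by auto
  have inj: "inj \<pi>" using permutes_inj[OF p(1)] .
  have im: "\<pi> ` x \<in> johnson_vertices (2 * w) w" if "x \<in> johnson_vertices (2 * w) w" for x
  proof -
    have "card (\<pi> ` x) = card x" using card_image[OF inj_on_subset[OF inj]] by auto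
    moreover have "\<pi> ` x \<subseteq> {0..<2 * w}"
      using that permutes_in_image[OF p(1)] unfolding johnson_vertices_def by blast
    ultimately show ?thesis using that unfolding johnson_vertices_def by simp
  qed
  have mem: "map (\<lambda>e. e \<in> \<pi> ` x) ks = map (\<lambda>e. e \<in> x) es" for x
    unfolding p(2)[symmetric] using inj by (auto simp: inj_image_mem_iff)
  have eq: "(x \<in> C1) = ((\<pi> ` x \<in> P_cell1 k w) = s)" if "x \<in> johnson_vertices (2 * w) w" for x
    using C[OF that] P[OF im[OF that]] mem by simp
  show ?thesis
  proof (cases s)
    case True
    then have "\<forall>x\<in>johnson_vertices (2 * w) w. (x \<in> C1) = (\<pi> ` x \<in> P_cell1 k w)" using eq by auto
    then show ?thesis using p(1) unfolding equivalent_partitions_def equivalent_funs_def P_part_def by auto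
  next
    case False
    then have "\<forall>x\<in>johnson_vertices (2 * w) w. (x \<in> C1) = (\<pi> ` x \<in> johnson_vertices (2 * w) w - P_cell1 k w)"
      using eq im by auto
    then show ?thesis using p(1) unfolding equivalent_partitions_def equivalent_funs_def P_part_def by auto
  qed
qed

lemma bits_simps:
  "bits 2 x = [if 0 \<in> x then 1 else 0, if 1 \<in> x then 1 else 0]"
  "bits 3 x = [if 0 \<in> x then 1 else 0, if 1 \<in> x then 1 else 0, if 2 \<in> x then 1 else 0]"
  "bits 5 x = [if 0 \<in> x then 1 else 0, if 1 \<in> x then 1 else 0, if 2 \<in> x then 1 else 0,
    if 3 \<in> x then 1 else 0, if 4 \<in> x then 1 else 0]"
  unfolding bits_def by (simp_all add: upt_rec numeral_eq_Suc)

text \<open>The truth tables become comparisons and multiplexers, the shape in which the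
  classification yields \<open>C1\<close>.\<close>

lemma mem_P_cell1:
  assumes "x \<in> johnson_vertices (2 * w) w"
  shows "x \<in> P_cell1 1 w \<longleftrightarrow> (3 \<in> x) = (4 \<in> x) \<and> (0 \<in> x) \<noteq> (3 \<in> x)"
    "x \<in> P_cell1 2 w \<longleftrightarrow> (0 \<in> x) = (1 \<in> x)"
    "x \<in> P_cell1 3 w \<longleftrightarrow> (if (0 \<in> x) = (3 \<in> x) then (1 \<in> x) = (0 \<in> x) else (2 \<in> x) = (0 \<in> x))"
    "x \<in> P_cell1 4 w \<longleftrightarrow> (1 \<in> x) = (2 \<in> x) \<and> (0 \<in> x) = (1 \<in> x)"
proof -
  show "x \<in> P_cell1 1 w \<longleftrightarrow> (3 \<in> x) = (4 \<in> x) \<and> (0 \<in> x) \<noteq> (3 \<in> x)"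
    using assms unfolding P_cell1_def B1_def bits_simps
    by (cases "0 \<in> x"; cases "1 \<in> x"; cases "2 \<in> x"; cases "3 \<in> x"; cases "4 \<in> x") simp_all
  show "x \<in> P_cell1 2 w \<longleftrightarrow> (0 \<in> x) = (1 \<in> x)"
    using assms unfolding P_cell1_def bits_simps
    by (cases "0 \<in> x"; cases "1 \<in> x") simp_all
  show "x \<in> P_cell1 3 w \<longleftrightarrow> (if (0 \<in> x) = (3 \<in> x) then (1 \<in> x) = (0 \<in> x) else (2 \<in> x) = (0 \<in> x))"
    using assms unfolding P_cell1_def B3_def bits_simps
    by (cases "0 \<in> x"; cases "1 \<in> x"; cases "2 \<in> x"; cases "3 \<in> x"; cases "4 \<in> x") simp_all
  show "x \<in> P_cell1 4 w \<longleftrightarrow> (1 \<in> x) = (2 \<in> x) \<and> (0 \<in> x) = (1 \<in> x)"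
    using assms unfolding P_cell1_def bits_simps
    by (cases "0 \<in> x"; cases "1 \<in> x"; cases "2 \<in> x") simp_all
qed

lemma equivalent_P2:
  assumes "w \<ge> 1" "distinct [i, a]" "{i, a} \<subseteq> {0..<2 * w}"
    and "\<And>x. x \<in> johnson_vertices (2 * w) w \<Longrightarrow> x \<in> C1 \<longleftrightarrow> ((i \<in> x) = (a \<in> x)) = s"
  shows "equivalent_partitions (2 * w) w (C1, C2) (P_part 2 w)"
  by (rule equivalent_partitionsI[of "[i, a]" "[0, 1]" _ _ "\<lambda>l. l ! 0 = l ! 1" _ s])
    (use assms mem_P_cell1 in auto)

lemma equivalent_P4:
  assumes "w \<ge> 2" "distinct [i, a, b]" "{i, a, b} \<subseteq> {0..<2 * w}"
    and "\<And>x. x \<in> johnson_vertices (2 * w) w \<Longrightarrow> x \<in> C1 \<longleftrightarrow> ((a \<in> x) = (b \<in> x) \<and> (i \<in> x) = (a \<in> x)) = s"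
  shows "equivalent_partitions (2 * w) w (C1, C2) (P_part 4 w)"
  by (rule equivalent_partitionsI[of "[i, a, b]" "[0, 1, 2]" _ _ "\<lambda>l. l ! 1 = l ! 2 \<and> l ! 0 = l ! 1" _ s])
    (use assms mem_P_cell1 in auto)

lemma equivalent_P1:
  assumes "w \<ge> 3" "distinct [i, a, b]" "{i, a, b} \<subseteq> {0..<2 * w}"
    and "\<And>x. x \<in> johnson_vertices (2 * w) w \<Longrightarrow> x \<in> C1 \<longleftrightarrow> ((a \<in> x) = (b \<in> x) \<and> (i \<in> x) \<noteq> (a \<in> x)) = s"
  shows "equivalent_partitions (2 * w) w (C1, C2) (P_part 1 w)"
  by (rule equivalent_partitionsI[of "[i, a, b]" "[0, 3, 4]" _ _ "\<lambda>l. l ! 1 = l ! 2 \<and> l ! 0 \<noteq> l ! 1" _ s])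
    (use assms mem_P_cell1 in auto)

lemma equivalent_P3:
  assumes "w \<ge> 2" "distinct [a, i, q, b]" "{a, i, q, b} \<subseteq> {0..<2 * w}"
    and "\<And>x. x \<in> johnson_vertices (2 * w) w \<Longrightarrow> x \<in> C1 \<longleftrightarrow>
      (if (a \<in> x) = (b \<in> x) then (i \<in> x) = (a \<in> x) else (q \<in> x) = (a \<in> x)) = s"
  shows "equivalent_partitions (2 * w) w (C1, C2) (P_part 3 w)"
  by (rule equivalent_partitionsI[of "[a, i, q, b]" "[0, 1, 2, 3]" _ _
        "\<lambda>l. if l ! 0 = l ! 3 then l ! 1 = l ! 0 else l ! 2 = l ! 0" _ s])
    (use assms mem_P_cell1 in auto)

text \<open>For \<open>q = b\<close> the second branch is constant, and the function is a
  conjunction of two comparisons or its negation: \<open>P_part 4\<close> or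
  \<open>P_part 1\<close>. For four distinct variables it is \<open>P_part 3\<close>.\<close>

lemma mux_equivalent:
  assumes w: "w \<ge> 3" and d: "distinct [i, a, b]" "q \<notin> {i, a}" "{i, a, b, q} \<subseteq> {0..<2 * w}"
    and C: "\<And>x. x \<in> johnson_vertices (2 * w) w \<Longrightarrow> x \<in> C1 \<longleftrightarrow>
      (if ((a \<in> x) = (b \<in> x)) = e1 then ((i \<in> x) = (a \<in> x)) = e2 else ((q \<in> x) = (a \<in> x)) = e3)"
  shows "\<exists>k\<in>{1, 2, 3, 4}. equivalent_partitions (2 * w) w (C1, C2) (P_part k w)"
proof (cases "q = b")
  case True
  define s where "s = (e1 = e3)"
  have C': "x \<in> C1 \<longleftrightarrow> ((((a \<in> x) = (b \<in> x)) = e1 \<and> ((i \<in> x) = (a \<in> x)) = (e2 = s)) = s)"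
    if "x \<in> johnson_vertices (2 * w) w" for x
    using C[OF that] unfolding True s_def by (cases e1; cases e2; cases e3) auto
  \<comment> \<open>The conjunction says either that \<open>i\<close>, \<open>a\<close>,
    \<open>b\<close> all agree or that exactly one of them, in turn \<open>i\<close>,
    \<open>b\<close>, \<open>a\<close>, differs from the other two.\<close>
  consider "e1" "e2 = s" | "e1" "e2 \<noteq> s" | "\<not> e1" "e2 = s" | "\<not> e1" "e2 \<noteq> s" by auto
  then show ?thesis
  proof cases
    case 1
    have "equivalent_partitions (2 * w) w (C1, C2) (P_part 4 w)"
      by (rule equivalent_P4[of w i a b _ s]) (use w d C' 1 in auto)
    then show ?thesis by blast
  next
    case 2
    have "equivalent_partitions (2 * w) w (C1, C2) (P_part 1 w)"
      by (rule equivalent_P1[of w i a b _ s]) (use w d C' 2 in auto)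
    then show ?thesis by blast
  next
    case 3
    have "equivalent_partitions (2 * w) w (C1, C2) (P_part 1 w)"
      by (rule equivalent_P1[of w b i a _ s]) (use w d C' 3 in auto)
    then show ?thesis by blast
  next
    case 4
    have "equivalent_partitions (2 * w) w (C1, C2) (P_part 1 w)"
      by (rule equivalent_P1[of w a i b _ s]) (use w d C' 4 in auto)
    then show ?thesis by blast
  qed
next
  case False
  have main: "equivalent_partitions (2 * w) w (C1, C2) (P_part 3 w)"
    if d: "distinct [i, a, b, q]" "{i, a, b, q} \<subseteq> {0..<2 * w}"
    and C: "\<And>x. x \<in> johnson_vertices (2 * w) w \<Longrightarrow> x \<in> C1 \<longleftrightarrow>
      (if (a \<in> x) = (b \<in> x) then ((i \<in> x) = (a \<in> x)) = e2 else ((q \<in> x) = (a \<in> x)) = e3)" for i q e2 e3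
  proof (cases "e2 = e3")
    case True
    show ?thesis by (rule equivalent_P3[of w a i q b _ e2]) (use w d C True in auto)
  next
    case False
    \<comment> \<open>Where \<open>a\<close> and \<open>b\<close> differ, comparing with
      \<open>b\<close> negates comparing with \<open>a\<close>; exchanging their roles makes the two
      signs equal.\<close>
    show ?thesis by (rule equivalent_P3[of w b i q a _ e2]) (use w d C False in auto)
  qed
  have "equivalent_partitions (2 * w) w (C1, C2) (P_part 3 w)"
  proof (cases e1)
    case True
    show ?thesis by (rule main[of i q e2 e3]) (use d False C True in auto)
  next
    case F: False
    \<comment> \<open>Negating the selector swaps the two branches.\<close>
    show ?thesis by (rule main[of q i e3 e2]) (use d False C F in auto)
  qed
  then show ?thesis by blast
qed

section \<open>Neighbour counts and the quotient matrix\<close>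

lemma nbsum_indicator:
  assumes x: "x \<in> johnson_vertices n w" and w: "w \<ge> 1" and D: "D \<subseteq> johnson_vertices n w"
  shows "nbsum {0..<n} (\<lambda>y. if y \<in> D then 1 else 0) x = int (card {y\<in>D. johnson_adj n w x y})"
proof -
  have xs: "x \<subseteq> {0..<n}" "card x = w" "finite x" using x finite_subset unfolding johnson_vertices_def by auto
  let ?A = "x \<times> ({0..<n} - x)"
  let ?t = "\<lambda>(i, j). insert j (x - {i})"
  have inj: "inj_on ?t ?A"
  proof (rule inj_onI)
    fix p p' assume "p \<in> ?A" "p' \<in> ?A" and eq: "?t p = ?t p'"
    then obtain i j i' j' where p: "p = (i, j)" "p' = (i', j')" "i \<in> x" "j \<notin> x" "i' \<in> x" "j' \<notin> x" by auto
    have e: "insert j (x - {i}) = insert j' (x - {i'})" using eq p by simp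
    have "j = j'" using e p by (metis Diff_iff insertE insertI1)
    moreover have "i = i'" using e p by (metis Diff_iff insertE insertI1 insertCI singletonD)
    ultimately show "p = p'" using p by simp
  qed
  have img: "{y\<in>D. johnson_adj n w x y} = ?t ` {p\<in>?A. ?t p \<in> D}"
  proof (intro set_eqI iffI)
    fix y assume "y \<in> {y\<in>D. johnson_adj n w x y}"
    then have y: "y \<in> D" "y \<subseteq> {0..<n}" "card y = w" "card (x \<inter> y) = w - 1"
      unfolding johnson_adj_def johnson_vertices_def by auto
    have fy: "finite y" using y finite_subset by auto
    \<comment> \<open>Subtraction on naturals is truncated; \<open>w \<ge> 1\<close> makes
      \<open>w - (w - 1)\<close> equal to 1.\<close>
    have "card (x - y) = 1" "card (y - x) = 1"
      using card_Diff_subset_Int[of x y] card_Diff_subset_Int[of y x] xs y fy w by (simp_all add: Int_commute)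
    then obtain i j where ij: "x - y = {i}" "y - x = {j}" by (auto simp: card_1_singleton_iff)
    then have "y = insert j (x - {i})" "i \<in> x" "j \<in> {0..<n} - x" using y by auto
    then show "y \<in> ?t ` {p\<in>?A. ?t p \<in> D}" using y(1) by (intro image_eqI[of _ _ "(i, j)"]) auto
  next
    fix y assume "y \<in> ?t ` {p\<in>?A. ?t p \<in> D}"
    then obtain i j where ij: "y = insert j (x - {i})" "i \<in> x" "j \<notin> x" "y \<in> D" by auto
    have "x \<inter> y = x - {i}" using ij by auto
    then have "card (x \<inter> y) = w - 1" using xs ij by simp
    then show "y \<in> {y\<in>D. johnson_adj n w x y}" using ij x D unfolding johnson_adj_def by auto
  qed
  have "card {y\<in>D. johnson_adj n w x y} = card {p\<in>?A. ?t p \<in> D}"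
    unfolding img by (intro card_image inj_on_subset[OF inj]) auto
  moreover have "nbsum {0..<n} (\<lambda>y. if y \<in> D then 1 else 0) x = (\<Sum>p\<in>?A. if ?t p \<in> D then 1 else 0)"
    unfolding nbsum_def by (simp add: sum.cartesian_product case_prod_unfold)
  moreover have "(\<Sum>p\<in>?A. if ?t p \<in> D then 1 else 0) = int (card {p\<in>?A. ?t p \<in> D})"
    using xs by (simp add: sum.If_cases Int_def)
  ultimately show ?thesis by simp
qed

lemma johnson_adj_sym: "johnson_adj n w x y = johnson_adj n w y x"
  unfolding johnson_adj_def by (auto simp: Int_commute)

lemma card_adj_double_count:
  assumes "finite C1" "finite C2"
    and "\<And>x. x \<in> C1 \<Longrightarrow> card {y\<in>C2. johnson_adj n w x y} = b"
    and "\<And>x. x \<in> C2 \<Longrightarrow> card {y\<in>C1. johnson_adj n w x y} = c"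
  shows "card C1 * b = card C2 * c"
proof -
  have "card C1 * b = (\<Sum>x\<in>C1. card {y\<in>C2. johnson_adj n w x y})" using assms(3) by simp
  also have "\<dots> = (\<Sum>x\<in>C1. \<Sum>y\<in>C2. if johnson_adj n w x y then 1 else 0)"
    using assms(2) by (simp add: sum.If_cases Int_def)
  also have "\<dots> = (\<Sum>y\<in>C2. \<Sum>x\<in>C1. if johnson_adj n w x y then 1 else 0)" by (rule sum.swap)
  also have "\<dots> = (\<Sum>y\<in>C2. card {x\<in>C1. johnson_adj n w y x})"
    using assms(1) by (simp add: sum.If_cases Int_def johnson_adj_sym)
  also have "\<dots> = card C2 * c" using assms(4) by simp
  finally show ?thesis .
qed

locale johnson_partition =
  fixes w a b c d :: nat and C1 C2 :: "nat set set"
  assumes w4: "w \<ge> 4"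
    and eq: "equitable_2partition (2 * w) w C1 C2 a b c d"
    and ev: "is_eigenvalue_2x2 a b c d (johnson_eigenvalue (2 * w) w 2)"
begin

definition V :: "nat set" where "V = {0..<2 * w}"

definition f :: "nat set \<Rightarrow> int" where "f x = (if x \<in> C1 then 1 else 0)"

lemma V_basic: "finite V" "card V = 2 * w" "johnson_vertices (2 * w) w = slice V w"
  unfolding V_def slice_johnson by auto

lemma f01: "f x \<in> {0, 1}" unfolding f_def by simp

lemma cells: "C1 \<noteq> {}" "C2 \<noteq> {}" "C1 \<inter> C2 = {}" "C1 \<union> C2 = slice V w" "finite C1" "finite C2"
proof -
  show "C1 \<noteq> {}" "C2 \<noteq> {}" "C1 \<inter> C2 = {}" and u: "C1 \<union> C2 = slice V w"
    using eq unfolding equitable_2partition_def V_basic(3)[symmetric] by auto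
  have "finite (slice V w)" using V_basic by simp
  then show "finite C1" "finite C2" using u by (metis finite_Un)+
qed

lemma degrees:
  "x \<in> C1 \<Longrightarrow> card {y\<in>C1. johnson_adj (2 * w) w x y} = a"
  "x \<in> C1 \<Longrightarrow> card {y\<in>C2. johnson_adj (2 * w) w x y} = b"
  "x \<in> C2 \<Longrightarrow> card {y\<in>C1. johnson_adj (2 * w) w x y} = c"
  "x \<in> C2 \<Longrightarrow> card {y\<in>C2. johnson_adj (2 * w) w x y} = d"
  using eq unfolding equitable_2partition_def by auto

lemma nbsum_f:
  assumes "x \<in> slice V w"
  shows "nbsum V f x = (if x \<in> C1 then int a else int c)"
proof -
  have "nbsum V f x = int (card {y\<in>C1. johnson_adj (2 * w) w x y})"
    using nbsum_indicator[of x "2 * w" w C1] assms cells w4 unfolding V_basic(3) f_def[abs_def] V_def by auto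
  then show ?thesis using degrees assms cells by (cases "x \<in> C1") auto
qed

lemma degree_sum:
  assumes "x \<in> slice V w"
  shows "card {y\<in>C1. johnson_adj (2 * w) w x y} + card {y\<in>C2. johnson_adj (2 * w) w x y} = w * w"
proof -
  have nb: "nbsum V (\<lambda>y. if y \<in> D then 1 else 0) x = int (card {y\<in>D. johnson_adj (2 * w) w x y})"
    if "D \<subseteq> slice V w" for D
    using nbsum_indicator[of x "2 * w" w D] assms that w4 unfolding V_basic(3) V_def by auto
  have xs: "finite x" "x \<subseteq> V" "card x = w"
    using assms slice_finite_mem[OF V_basic(1) assms] unfolding slice_def by auto
  have "nbsum V (\<lambda>y. if y \<in> C1 then 1 else 0) x + nbsum V (\<lambda>y. if y \<in> C2 then 1 else 0) x
    = (\<Sum>i\<in>x. \<Sum>j\<in>V - x. 1)"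
    unfolding nbsum_def sum.distrib[symmetric]
  proof (intro sum.cong refl)
    fix i j assume ij: "i \<in> x" "j \<in> V - x"
    have "x - {i} \<in> slice (V - {i, j}) (w - 1)" using ij xs unfolding slice_def by auto
    then have "insert j (x - {i}) \<in> slice V w"
      using insert_in_slice[OF V_basic(1), of "x - {i}" "{i, j}" "w - 1" j] ij w4 by auto
    then show "(if insert j (x - {i}) \<in> C1 then 1 else 0) + (if insert j (x - {i}) \<in> C2 then 1 else 0) = (1::int)"
      using cells by auto
  qed
  also have "\<dots> = int (w * w)" using xs V_basic by (simp add: card_Diff_subset)
  finally have "int (card {y\<in>C1. johnson_adj (2 * w) w x y} + card {y\<in>C2. johnson_adj (2 * w) w x y}) = int (w * w)"
    using nb[OF Un_upper1[of C1 C2, unfolded cells(4)]] nb[OF Un_upper2[of C2 C1, unfolded cells(4)]] by simp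
  then show ?thesis by linarith
qed

lemma row_sums: "a + b = w * w" "c + d = w * w"
proof -
  obtain x y where "x \<in> C1" "y \<in> C2" using cells by auto
  then show "a + b = w * w" "c + d = w * w"
    using degree_sum[of x] degree_sum[of y] degrees[of x] degrees[of y] cells by auto
qed

text \<open>With both row sums \<open>w * w\<close>, the eigenvalues of the matrix are
  \<open>w * w\<close>, on constant vectors, and \<open>a - c\<close>. The given one differs from
  \<open>w * w\<close> by \<open>4 * w - 2\<close>.\<close>

lemma eigenvalue_diff: "int a - int c = (int w - 2)\<^sup>2 - 2"
proof -
  define l where "l = (real w - 2) * (real w - 2) - 2"
  obtain v1 v2 :: real where v: "(v1, v2) \<noteq> (0, 0)" "a * v1 + b * v2 = l * v1" "c * v1 + d * v2 = l * v2"
    using ev unfolding is_eigenvalue_2x2_def johnson_eigenvalue_def l_def by auto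
  have rs: "real b = real w * real w - real a" "real d = real w * real w - real c"
    using row_sums by (metis add_diff_cancel_left' of_nat_add of_nat_mult)+
  have "(real a - real c - l) * (v1 - v2) = 0"
    using v(2,3) unfolding rs by (simp add: algebra_simps)
  moreover have "v1 \<noteq> v2"
  proof
    assume e: "v1 = v2"
    then have "(real w * real w - l) * v1 = 0" using v(2) unfolding rs by (simp add: algebra_simps)
    moreover have "real w * real w - l \<noteq> 0" using w4 unfolding l_def by (simp add: algebra_simps)
    ultimately show False using v(1) e by auto
  qed
  ultimately have "real a - real c = l" by simp
  then have "real_of_int (int a - int c) = real_of_int ((int w - 2)\<^sup>2 - 2)"
    unfolding l_def by (simp add: power2_eq_square)
  then show ?thesis by (simp only: of_int_eq_iff)
qed

lemma bc_sum: "b + c + 2 = 4 * w"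
proof -
  have "int a + int b = int w * int w" using row_sums(1) by (metis of_nat_add of_nat_mult)
  then have "int b + int c + 2 = 4 * int w"
    using eigenvalue_diff by (simp add: power2_eq_square algebra_simps)
  then show ?thesis by linarith
qed

lemma double_count: "card C1 * b = card C2 * c"
  using card_adj_double_count[of C1 C2] cells(5,6) degrees by blast

lemma bc_pos: "b > 0" "c > 0"
proof -
  have "card C1 > 0" "card C2 > 0" using cells by (auto simp: card_gt_0_iff)
  then have "b = 0 \<longleftrightarrow> c = 0" using double_count by (metis mult_is_0 neq0_conv)
  then show "b > 0" "c > 0" using bc_sum w4 by auto
qed

text \<open>The size of the vertices left after three differences.\<close>

definition k :: nat where "k = w - 3"

lemma k: "w = k + 3" using w4 unfolding k_def by simp

lemma eigenfun_f: "eigenfun V (k + 3) ((int k + 1)\<^sup>2 - 2) (int c) f"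
proof -
  have "int a = (int k + 1)\<^sup>2 - 2 + int c" using eigenvalue_diff k by (simp add: algebra_simps)
  then show ?thesis unfolding eigenfun_def k[symmetric] using nbsum_f by (auto simp: f_def)
qed

text \<open>Since \<open>b\<close> and \<open>c\<close> are positive with sum
  \<open>4 * w - 2\<close>, the one divisible by \<open>w\<close> is \<open>w\<close>,
  \<open>2 * w\<close> or \<open>3 * w\<close>; this and the row sums fix the matrix.\<close>

lemma matrix_cases:
  assumes "(\<exists>m. b = w * m) \<or> (\<exists>m. c = w * m)"
  shows "(b \<ge> c \<longrightarrow> (a, b, c, d) \<in> {(w^2-3*w+2, 3*w-2, w, w^2-w), (w^2-2*w, 2*w, 2*w-2, w^2-2*w+2),
                      (w^2-3*w, 3*w, w-2, w^2-w+2)}) \<and>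
    (c \<ge> b \<longrightarrow> (d, c, b, a) \<in> {(w^2-3*w+2, 3*w-2, w, w^2-w), (w^2-2*w, 2*w, 2*w-2, w^2-2*w+2),
                      (w^2-3*w, 3*w, w-2, w^2-w+2)})"
proof -
  have m3: "m \<in> {1, 2, 3}" if "w * m + u + 2 = 4 * w" "w * m > 0" for m u
  proof -
    have "w * m < w * 4" using that by linarith
    then have "m < 4" by simp
    then show ?thesis using that by (cases "m = 0") auto
  qed
  define N where "N = w * w"
  have sq: "4 * w \<le> N" "a + b = N" "c + d = N" "w\<^sup>2 = N"
    using w4 row_sums unfolding N_def by (auto simp: power2_eq_square)
  show ?thesis using assms
  proof (elim disjE exE)
    fix m assume m: "b = w * m"
    then have "m \<in> {1, 2, 3}" using m3[of m c] bc_sum bc_pos by auto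
    then consider "m = 1" | "m = 2" | "m = 3" by auto
    then show ?thesis
    proof cases
      case 1
      then have e: "b = w" using m by simp
      then have "c = 3 * w - 2" "a = N - w" "d = N - 3 * w + 2" using bc_sum sq(1-3) w4 by arith+
      then show ?thesis using e w4 by (simp add: sq(4))
    next
      case 2
      then have e: "b = 2 * w" using m by simp
      then have "c = 2 * w - 2" "a = N - 2 * w" "d = N - 2 * w + 2" using bc_sum sq(1-3) w4 by arith+
      then show ?thesis using e w4 by (simp add: sq(4))
    next
      case 3
      then have e: "b = 3 * w" using m by simp
      then have "c = w - 2" "a = N - 3 * w" "d = N - w + 2" using bc_sum sq(1-3) w4 by arith+
      then show ?thesis using e w4 by (simp add: sq(4))
    qed
  next
    fix m assume m: "c = w * m"
    then have "m \<in> {1, 2, 3}" using m3[of m b] bc_sum bc_pos by (auto simp: add.commute)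
    then consider "m = 1" | "m = 2" | "m = 3" by auto
    then show ?thesis
    proof cases
      case 1
      then have e: "c = w" using m by simp
      then have "b = 3 * w - 2" "d = N - w" "a = N - 3 * w + 2" using bc_sum sq(1-3) w4 by arith+
      then show ?thesis using e w4 by (simp add: sq(4))
    next
      case 2
      then have e: "c = 2 * w" using m by simp
      then have "b = 2 * w - 2" "d = N - 2 * w" "a = N - 2 * w + 2" using bc_sum sq(1-3) w4 by arith+
      then show ?thesis using e w4 by (simp add: sq(4))
    next
      case 3
      then have e: "c = 3 * w" using m by simp
      then have "b = w - 2" "d = N - 3 * w" "a = N - w + 2" using bc_sum sq(1-3) w4 by arith+
      then show ?thesis using e w4 by (simp add: sq(4))
    qed
  qed
qed

section \<open>Divisibility of the matrix entries and classification\<close>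

lemma slice_boolean_instance:
  assumes "w \<ge> 5"
  shows "\<exists>H. slice_boolean V w f H"
proof -
  have cV: "card V = 2 * (k + 3)" using V_basic k by simp
  have "\<forall>i j. \<exists>h. i \<in> V \<and> j \<in> V \<and> i \<noteq> j \<longrightarrow> (\<Sum>c\<in>V - {i, j}. \<bar>h c\<bar>) \<in> {0, 2} \<and>
     (\<forall>x\<in>slice (V - {i, j}) (k + 2). 2 * (f (insert i x) - f (insert j x)) = lin (V - {i, j}) h x)"
    using diff_linear_form[OF V_basic(1) cV eigenfun_f f01] by blast
  then obtain h where h: "\<And>i j. i \<in> V \<Longrightarrow> j \<in> V \<Longrightarrow> i \<noteq> j \<Longrightarrow> (\<Sum>c\<in>V - {i, j}. \<bar>h i j c\<bar>) \<in> {0, 2}"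
    "\<And>i j x. i \<in> V \<Longrightarrow> j \<in> V \<Longrightarrow> i \<noteq> j \<Longrightarrow> x \<in> slice (V - {i, j}) (k + 2) \<Longrightarrow>
       2 * (f (insert i x) - f (insert j x)) = lin (V - {i, j}) (h i j) x"
    by metis
  have w1: "w - 1 = k + 2" using k by simp
  define H where "H i j c = (if c \<in> V - {i, j} then h i j c else 0)" for i j c
  have "slice_boolean V w f H"
  proof
    fix i j assume ij: "i \<in> V" "j \<in> V" "i \<noteq> j"
    have "(\<Sum>c\<in>V. \<bar>H i j c\<bar>) = (\<Sum>c\<in>V - {i, j}. \<bar>H i j c\<bar>)"
      using V_basic(1) by (intro sum.mono_neutral_right) (auto simp: H_def)
    also have "\<dots> = (\<Sum>c\<in>V - {i, j}. \<bar>h i j c\<bar>)" by (intro sum.cong) (auto simp: H_def)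
    finally show "(\<Sum>c\<in>V. \<bar>H i j c\<bar>) \<in> {0, 2}" using h(1)[OF ij] by simp
    fix x assume x: "x \<in> slice (V - {i, j}) (w - 1)"
    have "lin (V - {i, j}) (H i j) x = lin (V - {i, j}) (h i j) x"
      unfolding lin_def by (intro sum.cong) (auto simp: H_def)
    then show "2 * (f (insert i x) - f (insert j x)) = lin (V - {i, j}) (H i j) x"
      using h(2)[OF ij, of x] x w1 by simp
  qed (use V_basic assms f01 in \<open>auto simp: H_def\<close>)
  then show ?thesis by blast
qed

lemma twin_set:
  assumes "w \<ge> 5"
  obtains T where "T \<subseteq> V" "card T + 5 \<ge> 2 * w"
    "\<And>i j. i \<in> T \<Longrightarrow> j \<in> T \<Longrightarrow> i \<noteq> j \<Longrightarrow> twin V (w - 1) f i j"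
  using slice_boolean_instance[OF assms] slice_boolean.large_twin_set by metis

text \<open>All neighbours \<open>x - {i} \<union> {j}\<close> of a vertex \<open>x \<subseteq> T\<close> with the same \<open>j\<close> lie in the same cell, so
  the entries of the row of \<open>x\<close> are multiples of \<open>w\<close>.\<close>
lemma degree_multiple:
  assumes w5: "w \<ge> 5"
  shows "(\<exists>m. b = w * m) \<or> (\<exists>m. c = w * m)"
proof -
  obtain T where T: "T \<subseteq> V" "card T + 5 \<ge> 2 * w"
    "\<And>i j. i \<in> T \<Longrightarrow> j \<in> T \<Longrightarrow> i \<noteq> j \<Longrightarrow> twin V (w - 1) f i j" by (rule twin_set[OF w5]) blast
  have fT: "finite T" using T V_basic finite_subset by blast
  have "w \<le> card T" using T(2) w5 by linarith
  then obtain x where x: "x \<in> slice T w" using slice_nonempty[OF fT] by blast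
  then have xs: "x \<subseteq> T" "card x = w" "finite x" using slice_finite_mem[OF fT x] unfolding slice_def by auto
  have "x \<noteq> {}" using xs w5 by auto
  then obtain p where p: "p \<in> x" by auto
  have xV: "x \<in> slice V w" using xs T(1) unfolding slice_def by auto
  have ins: "insert j (x - {i}) \<in> slice V (Suc (w - 1))" if "i \<in> x" "j \<in> V - x" for i j
  proof -
    have "x - {i} \<in> slice (V - {i, j}) (w - 1)" using that xs T(1) unfolding slice_def by auto
    then show ?thesis using insert_in_slice[OF V_basic(1)] that by blast
  qed
  have "nbsum V f x = (\<Sum>i\<in>x. \<Sum>j\<in>V - x. f (insert j (x - {p})))"
    unfolding nbsum_def
  proof (intro sum.cong refl)
    fix i j assume ij: "i \<in> x" "j \<in> V - x"
    have "insert j (x - {i}) - T = insert j (x - {p}) - T" using xs(1) by auto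
    then show "f (insert j (x - {i})) = f (insert j (x - {p}))"
      using slice_const_mod_twins[OF V_basic(1) T(1) T(3) ins[OF ij] ins[OF p ij(2)]] by blast
  qed
  then have dv: "int w dvd nbsum V f x" using xs by simp
  show ?thesis
  proof (cases "x \<in> C1")
    case True
    then have "w dvd a" using dv nbsum_f[OF xV] by simp
    then have "w dvd b" using row_sums(1) by (metis dvd_add_right_iff dvd_triv_left)
    then show ?thesis by (auto elim: dvdE)
  next
    case False
    then have "w dvd c" using dv nbsum_f[OF xV] by simp
    then show ?thesis by (auto elim: dvdE)
  qed
qed

text \<open>There is no room for a large twin set when \<open>w = 4\<close>. Instead, \<open>C1\<close> is closed under complements, so
  \<open>card C1 = 5 * c\<close> is even.\<close>
lemma degree_multiple_4:
  assumes w: "w = 4"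
  shows "(\<exists>m. b = w * m) \<or> (\<exists>m. c = w * m)"
proof -
  have cV: "card V = 2 * (k + 3)" using V_basic k by simp
  have C1s: "x \<subseteq> V" if "x \<in> C1" for x using that cells(4) unfolding slice_def by blast
  have cl: "V - x \<in> C1" if x: "x \<in> C1" for x
  proof -
    have "x \<in> slice V (k + 3)" using x cells(4) k by auto
    then have "f (V - x) = f x" using even_of_eigenfun[OF V_basic(1) cV eigenfun_f] by blast
    then show ?thesis using x unfolding f_def by (auto split: if_splits)
  qed
  have z: "0 \<in> V" unfolding V_def using w by simp
  \<comment> \<open>Complementation toggles the coordinate 0 and so splits \<open>C1\<close> into
    two halves of equal size.\<close>
  have "bij_betw (\<lambda>x. V - x) {x\<in>C1. 0 \<in> x} {x\<in>C1. 0 \<notin> x}"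
    by (rule bij_betw_byWitness[where f' = "\<lambda>x. V - x"]) (use cl C1s z in \<open>auto simp: double_diff\<close>)
  then have "card {x\<in>C1. 0 \<in> x} = card {x\<in>C1. 0 \<notin> x}" by (rule bij_betw_same_card)
  moreover have "card ({x\<in>C1. 0 \<in> x} \<union> {x\<in>C1. 0 \<notin> x}) = card {x\<in>C1. 0 \<in> x} + card {x\<in>C1. 0 \<notin> x}"
    using cells(5) by (intro card_Un_disjoint) auto
  moreover have "{x\<in>C1. 0 \<in> x} \<union> {x\<in>C1. 0 \<notin> x} = C1" by auto
  ultimately have ev: "even (card C1)" by simp
  \<comment> \<open>With 70 vertices and \<open>b + c = 14\<close>, double counting the edges
    between the cells gives \<open>card C1 = 5 * c\<close>.\<close>
  have "card (slice V w) = 8 choose 4" unfolding slice_def using n_subsets[OF V_basic(1)] V_basic(2) w by simp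
  then have "card (slice V w) = 70" by (simp add: numeral_eq_Suc)
  then have s: "int (card C2) = 70 - int (card C1)" using card_Un_disjoint[OF cells(5,6,3)] cells(4) by simp
  have s2: "int b = 14 - int c" using bc_sum w by simp
  have "int (card C1) * int b = int (card C2) * int c" using double_count by (metis of_nat_mult)
  then have "int (card C1) * (14 - int c) = (70 - int (card C1)) * int c" unfolding s2 s .
  then have "14 * int (card C1) = 70 * int c" by (simp add: algebra_simps)
  then have "card C1 = 5 * c" by simp
  then have "even c" using ev by simp
  then obtain m where m: "c = 2 * m" by (auto elim: evenE)
  show ?thesis
  proof (cases "even m")
    case True
    then show ?thesis using m w by (auto elim!: evenE)
  next
    case False
    then obtain n where n: "m = 2 * n + 1" by (auto elim: oddE)
    \<comment> \<open>Here \<open>c = 4 * n + 2\<close>, so \<open>b = 14 - c\<close> is the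
      multiple of 4.\<close>
    then have "b = w * (3 - n)" using m w bc_sum by simp
    then show ?thesis by blast
  qed
qed

lemma classification:
  assumes w5: "w \<ge> 5"
  shows "\<exists>k\<in>{1, 2, 3, 4}. equivalent_partitions (2 * w) w (C1, C2) (P_part k w)"
proof -
  obtain H where "slice_boolean V w f H" using slice_boolean_instance[OF w5] by blast
  then interpret S: slice_boolean V w f H .
  obtain T where T: "T \<subseteq> V" "card T + 5 \<ge> 2 * w"
    "\<And>i j. i \<in> T \<Longrightarrow> j \<in> T \<Longrightarrow> i \<noteq> j \<Longrightarrow> twin V (w - 1) f i j" by (rule twin_set[OF w5]) blast
  define K where "K = V - T"
  \<comment> \<open>Any representative of the trace \<open>y\<close> will do, because
    \<open>f\<close> depends only on the trace outside the twin set.\<close>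
  define F where "F y = f (SOME x. x \<in> slice V w \<and> x - T = y)" for y
  have F: "f x = F (x - T)" if x: "x \<in> slice V w" for x
  proof -
    define x' where "x' = (SOME x'. x' \<in> slice V w \<and> x' - T = x - T)"
    have x': "x' \<in> slice V w \<and> x' - T = x - T"
      unfolding x'_def by (rule someI[of _ x]) (use x in simp)
    then show ?thesis
      using slice_const_mod_twins[OF V_basic(1) T(1) T(3), of x x'] x w5 unfolding F_def x'_def[symmetric] by simp
  qed
  have F01: "F y \<in> {0, 1}" for y unfolding F_def using f01 .
  \<comment> \<open>Otherwise \<open>f\<close> would be constant, although both cells are
    nonempty.\<close>
  have "\<exists>i\<in>K. \<exists>y\<subseteq>K - {i}. F (insert i y) \<noteq> F y"
  proof (rule ccontr)
    assume "\<not> ?thesis"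
    then have step: "F (insert i y) = F y" if "i \<in> K" "y \<subseteq> K - {i}" for i y using that by blast
    have cst: "F y = F {}" if "finite y" "y \<subseteq> K" for y
      using that
    proof (induction y rule: finite_induct)
      case (insert i y)
      then show ?case using step[of i y] by auto
    qed simp
    have const: "f x = F {}" if "x \<in> slice V w" for x
    proof -
      have "finite (x - T)" "x - T \<subseteq> K"
        using slice_finite_mem[OF V_basic(1) that] that unfolding K_def slice_def by auto
      then show ?thesis using trans[OF F[OF that] cst] by blast
    qed
    obtain x y where "x \<in> C1" "y \<in> C2" using cells by auto
    then have "f x = 1" "f y = 0" "x \<in> slice V w" "y \<in> slice V w"
      using cells(3) unfolding f_def cells(4)[symmetric] by auto
    then show False using const[of x] const[of y] by simp
  qed
  then obtain i y0 where i: "i \<in> K" "y0 \<subseteq> K - {i}" "F (insert i y0) \<noteq> F y0" by blast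
  have KV: "K \<subseteq> {0..<2 * w}" unfolding K_def V_def by auto
  have mem: "x \<in> C1 \<longleftrightarrow> F (x - T) = 1" "x - T \<subseteq> K" if "x \<in> johnson_vertices (2 * w) w" for x
  proof -
    have x: "x \<in> slice V w" using that unfolding V_basic(3) .
    have "x \<in> C1 \<longleftrightarrow> f x = 1" unfolding f_def by simp
    then show "x \<in> C1 \<longleftrightarrow> F (x - T) = 1" using F[OF x] by simp
    show "x - T \<subseteq> K" using x unfolding K_def slice_def by auto
  qed
  have inT: "c \<in> x - T \<longleftrightarrow> c \<in> x" if "c \<in> K" for c x using that unfolding K_def by auto
  show ?thesis
  proof (rule boolean_quadratic_cases[of K F, OF F01 _ i])
    fix i assume "i \<in> K"
    then show "(\<forall>y\<subseteq>K - {i}. F (insert i y) = F y) \<or>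
      (\<exists>a\<in>K - {i}. \<exists>b\<in>K - {i}. \<exists>e e'. \<bar>e\<bar> = 1 \<and> \<bar>e'\<bar> = 1 \<and> (a = b \<longrightarrow> e = e') \<and>
       (\<forall>y\<subseteq>K - {i}. 2 * (F (insert i y) - F y) = e * sg a y + e' * sg b y))"
      unfolding K_def using S.diff_of_junta[of T F i] T F by blast
  next
    fix a e assume a: "a \<in> K" "a \<noteq> i" and form: "\<And>y. y \<subseteq> K \<Longrightarrow> F y = 1 \<longleftrightarrow> ((i \<in> y) = (a \<in> y)) = e"
    have "equivalent_partitions (2 * w) w (C1, C2) (P_part 2 w)"
    proof (rule equivalent_P2[of w i a _ e])
      fix x assume x: "x \<in> johnson_vertices (2 * w) w"
      show "x \<in> C1 \<longleftrightarrow> ((i \<in> x) = (a \<in> x)) = e"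
        using mem[OF x] form[OF mem(2)[OF x]] inT[OF i(1), of x] inT[OF a(1), of x] by simp
    qed (use w5 a i(1) KV in auto)
    then show ?thesis by blast
  next
    fix a b q e1 e2 e3 assume a: "a \<in> K" "b \<in> K" "q \<in> K" "distinct [i, a, b]" "q \<notin> {i, a}"
      and form: "\<And>y. y \<subseteq> K \<Longrightarrow> F y = 1 \<longleftrightarrow> (if ((a \<in> y) = (b \<in> y)) = e1 then ((i \<in> y) = (a \<in> y)) = e2
                                                          else ((q \<in> y) = (a \<in> y)) = e3)"
    show ?thesis
    proof (rule mux_equivalent[of w i a b q C1 e1 e2 e3, OF _ a(4,5)])
      fix x assume x: "x \<in> johnson_vertices (2 * w) w"
      show "x \<in> C1 \<longleftrightarrow> (if ((a \<in> x) = (b \<in> x)) = e1 then ((i \<in> x) = (a \<in> x)) = e2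
                                              else ((q \<in> x) = (a \<in> x)) = e3)"
        using mem[OF x] form[OF mem(2)[OF x]]
        unfolding inT[OF i(1), of x] inT[OF a(1), of x] inT[OF a(2), of x] inT[OF a(3), of x] by simp
    qed (use w5 a i(1) KV in auto)
  qed
qed

end

theorem theorem3:
  fixes w a b c d :: nat and C1 C2 :: "nat set set"
  assumes "w \<ge> 4"
    and "equitable_2partition (2*w) w C1 C2 a b c d"
    and "is_eigenvalue_2x2 a b c d (johnson_eigenvalue (2*w) w 2)"
  shows "(w \<ge> 7 \<longrightarrow>
            (\<exists>k\<in>{1,2,3,4}. equivalent_partitions (2*w) w (C1, C2) (P_part k w))) \<and>
         (w \<in> {4,5,6} \<longrightarrow>
            (let L = {(w^2-3*w+2, 3*w-2, w, w^2-w), (w^2-2*w, 2*w, 2*w-2, w^2-2*w+2),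
                      (w^2-3*w, 3*w, w-2, w^2-w+2)}
             in (b \<ge> c \<longrightarrow> (a, b, c, d) \<in> L) \<and> (c \<ge> b \<longrightarrow> (d, c, b, a) \<in> L)))"
proof -
  interpret johnson_partition w a b c d C1 C2 using assms by unfold_locales
  have "(\<exists>m. b = w * m) \<or> (\<exists>m. c = w * m)"
    using degree_multiple degree_multiple_4 assms(1) by (cases "w = 4") auto
  note matrix = matrix_cases[OF this]
  show ?thesis unfolding Let_def using matrix classification by (intro conjI impI) simp_all
qed

end
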